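(* Let $M$ be a smooth manifold with a pseudo-Riemannian metric $g$ and a bivector field $\pi$. Suppose that $(g,\pi)$ is $\nabla^\pi$-compatible, i.e. $\nabla^\pi\pi=0$ (so that $\pi$ is a Poisson tensor), and let $S$ be a symplectic leaf of $\pi$ with symplectic form $\omega_S$. Then $S$ is a totally geodesic submanifold of $(M,g)$ (that is, $\nabla_XY$ is tangent to $S$ for all vector fields $X,Y$ tangent to $S$, where $\nabla$ is the Levi-Civita connection of $g$), and $\omega_S$ is parallel with respect to the connection on $S$ obtained by restricting $\nabla$ to $S$.
   Context: All objects are smooth. For a bivector field $\pi$, the map $\#_\pi:T^*M\to TM$ is defined by $\beta(\#_\pi(\alpha))=\pi(\alpha,\beta)$. Let $\nabla$ be the Levi-Civita connection of $g$, acting also on 1-forms. For 1-forms $\alpha,\beta$ put $\nabla^\pi_\alpha\beta=\nabla_{\#_\pi(\alpha)}\beta$. The pair $(g,\pi)$ is called $\nabla^\pi$-compatible if $\nabla^\pi\pi=0$, i.e. for all 1-forms $\alpha,\beta,\gamma$, $$\#_\pi(\alpha)\cdot\pi(\beta,\gamma)-\pi(\nabla^\pi_\alpha\beta,\gamma)-\pi(\beta,\nabla^\pi_\alpha\gamma)=0 .$$ This condition implies that $\pi$ is a Poisson tensor. The symplectic leaves of $\pi$ are the maximal connected immersed submanifolds $S$ with $T_xS=\#_\pi(T_x^*M)$ for all $x\in S$; the symplectic form of $S$ is $\omega_S(\#_\pi(\alpha),\#_\pi(\beta))=\pi(\alpha,\beta)$. The restriction of $g$ to $S$ is not assumed non-degenerate.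 *)

theory Defs
  imports "HOL-Analysis.Analysis"
begin

section \<open>Smooth functions on open subsets of a linear subspace\<close>

text \<open>
  Model spaces are linear subspaces \<open>V\<close> of a Euclidean space, so that manifolds of every dimension
  from \<open>0\<close> to \<open>DIM('e)\<close> live in one type.  \<open>Ck_on k V A f\<close> says that \<open>f\<close> is of class \<open>C\<^sup>k\<close> on \<open>A\<close>;
  it is meant for \<open>A\<close> relatively open in \<open>V\<close>, where derivatives within \<open>V\<close> are unique on \<open>V\<close>.
\<close>

primrec Ck_on ::
  "nat \<Rightarrow> 'e::euclidean_space set \<Rightarrow> 'e set \<Rightarrow> ('e \<Rightarrow> 'b::real_normed_vector) \<Rightarrow> bool" where
  "Ck_on 0 V A f \<longleftrightarrow> continuous_on A f"
| "Ck_on (Suc k) V A f \<longleftrightarrow>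
     (\<forall>x\<in>A. f differentiable (at x within V)) \<and>
     (\<forall>v\<in>V. Ck_on k V A (\<lambda>x. frechet_derivative f (at x within V) v))"

definition smooth_on ::
  "'e::euclidean_space set \<Rightarrow> 'e set \<Rightarrow> ('e \<Rightarrow> 'b::real_normed_vector) \<Rightarrow> bool" where
  "smooth_on V A f \<longleftrightarrow> (\<forall>k. Ck_on k V A f)"


section \<open>Smooth manifolds\<close>

text \<open>A chart is its domain together with the coordinate map, whose values off the domain are
  irrelevant.\<close>

type_synonym ('a, 'e) chart = "'a set \<times> ('a \<Rightarrow> 'e)"

abbreviation chart_inv :: "('a, 'e) chart \<Rightarrow> 'e \<Rightarrow> 'a" where
  "chart_inv c \<equiv> inv_into (fst c) (snd c)"

record ('a, 'e) mfd =
  mtop  :: "'a topology"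
  model :: "'e set"
  atlas :: "('a, 'e) chart set"

abbreviation points :: "('a, 'e) mfd \<Rightarrow> 'a set" where
  "points M \<equiv> topspace (mtop M)"

definition smooth_manifold :: "('a, 'e::euclidean_space) mfd \<Rightarrow> bool" where
  "smooth_manifold M \<longleftrightarrow>
     Hausdorff_space (mtop M) \<and> second_countable (mtop M) \<and> subspace (model M) \<and>
     points M = (\<Union>c\<in>atlas M. fst c) \<and>
     (\<forall>c\<in>atlas M.
        openin (mtop M) (fst c) \<and>
        openin (top_of_set (model M)) (snd c ` fst c) \<and>
        homeomorphic_map (subtopology (mtop M) (fst c)) (top_of_set (snd c ` fst c)) (snd c)) \<and>
     (\<forall>c\<in>atlas M. \<forall>d\<in>atlas M.
        smooth_on (model M) (snd c ` (fst c \<inter> fst d)) (snd d \<circ> chart_inv c))"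

definition charts_at :: "('a, 'e) mfd \<Rightarrow> 'a \<Rightarrow> ('a, 'e) chart set" where
  "charts_at M p = {c \<in> atlas M. p \<in> fst c}"

definition chart_at :: "('a, 'e) mfd \<Rightarrow> 'a \<Rightarrow> ('a, 'e) chart" where
  "chart_at M p = (SOME c. c \<in> charts_at M p)"

definition smooth_fun ::
  "('a, 'e::euclidean_space) mfd \<Rightarrow> 'a set \<Rightarrow> ('a \<Rightarrow> 'b::real_normed_vector) \<Rightarrow> bool" where
  "smooth_fun M U f \<longleftrightarrow>
     (\<forall>c\<in>atlas M. smooth_on (model M) (snd c ` (fst c \<inter> U)) (f \<circ> chart_inv c))"

definition smooth_map ::
  "('a, 'e::euclidean_space) mfd \<Rightarrow> ('b, 'f::euclidean_space) mfd \<Rightarrow> ('a \<Rightarrow> 'b) \<Rightarrow> bool" where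
  "smooth_map A B F \<longleftrightarrow>
     continuous_map (mtop A) (mtop B) F \<and>
     (\<forall>c\<in>atlas A. \<forall>d\<in>atlas B.
        smooth_on (model A) (snd c ` {p \<in> fst c. F p \<in> fst d}) (snd d \<circ> F \<circ> chart_inv c))"


section \<open>Tangent vectors and covectors\<close>

text \<open>
  A tangent vector at \<open>p\<close> is the family of its coordinate representatives, indexed by the charts
  at \<open>p\<close> and compatible with the derivatives of the transition maps (and \<open>0\<close> at all other
  indices).  The vector space operations are pointwise.  \<open>coord_vector M c a p\<close> is the tangent
  vector at \<open>p\<close> with representative \<open>a\<close> in the chart \<open>c\<close>; for fixed \<open>a\<close> it is the coordinate field
  of \<open>c\<close> in the direction \<open>a\<close>.
\<close>

type_synonym ('a, 'e) tvec = "('a, 'e) chart \<Rightarrow> 'e"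
type_synonym ('a, 'e) covec = "('a, 'e) tvec \<Rightarrow> real"

definition coord_vector ::
  "('a, 'e::euclidean_space) mfd \<Rightarrow> ('a, 'e) chart \<Rightarrow> 'e \<Rightarrow> 'a \<Rightarrow> ('a, 'e) tvec" where
  "coord_vector M c a p =
     (\<lambda>d. if d \<in> charts_at M p
          then frechet_derivative (snd d \<circ> chart_inv c) (at (snd c p) within model M) a
          else 0)"

definition tangent_space :: "('a, 'e::euclidean_space) mfd \<Rightarrow> 'a \<Rightarrow> ('a, 'e) tvec set" where
  "tangent_space M p =
     {v. \<forall>c\<in>charts_at M p. v c \<in> model M \<and> v = coord_vector M c (v c) p}"

text \<open>The derivative \<open>v \<cdot> f\<close> of a function \<open>f\<close> defined near \<open>p\<close>, and the differential of a map;
  only the germ of \<open>f\<close> (resp. \<open>F\<close>) at \<open>p\<close> matters.\<close>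

definition dirder ::
  "('a, 'e::euclidean_space) mfd \<Rightarrow> ('a \<Rightarrow> 'b::real_normed_vector) \<Rightarrow> 'a \<Rightarrow> ('a, 'e) tvec \<Rightarrow> 'b" where
  "dirder M f p v =
     (let c = chart_at M p
      in frechet_derivative (f \<circ> chart_inv c) (at (snd c p) within model M) (v c))"

definition tangent_map ::
  "('a, 'e::euclidean_space) mfd \<Rightarrow> ('b, 'f::euclidean_space) mfd \<Rightarrow> ('a \<Rightarrow> 'b) \<Rightarrow> 'a
    \<Rightarrow> ('a, 'e) tvec \<Rightarrow> ('b, 'f) tvec" where
  "tangent_map A B F p v =
     (\<lambda>d. if d \<in> charts_at B (F p) then dirder A (snd d \<circ> F) p v else 0)"

definition linear_form :: "('x \<Rightarrow> 'v::real_vector) set \<Rightarrow> (('x \<Rightarrow> 'v) \<Rightarrow> real) \<Rightarrow> bool" where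
  "linear_form T \<theta> \<longleftrightarrow>
     (\<forall>v\<in>T. \<forall>w\<in>T. \<theta> (\<lambda>c. v c + w c) = \<theta> v + \<theta> w) \<and>
     (\<forall>r. \<forall>v\<in>T. \<theta> (\<lambda>c. r *\<^sub>R v c) = r * \<theta> v)"

definition bilinear_form ::
  "('x \<Rightarrow> 'v::real_vector) set \<Rightarrow> (('x \<Rightarrow> 'v) \<Rightarrow> ('x \<Rightarrow> 'v) \<Rightarrow> real) \<Rightarrow> bool" where
  "bilinear_form T B \<longleftrightarrow> (\<forall>u\<in>T. linear_form T (B u) \<and> linear_form T (\<lambda>v. B v u))"

text \<open>Covectors vanish off the tangent space, which makes them determined by their values on it.\<close>

definition cotangent_space :: "('a, 'e::euclidean_space) mfd \<Rightarrow> 'a \<Rightarrow> ('a, 'e) covec set" where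
  "cotangent_space M p =
     {\<theta>. linear_form (tangent_space M p) \<theta> \<and> (\<forall>v. v \<notin> tangent_space M p \<longrightarrow> \<theta> v = 0)}"


section \<open>Fields over open sets\<close>

definition vector_fields ::
  "('a, 'e::euclidean_space) mfd \<Rightarrow> 'a set \<Rightarrow> ('a \<Rightarrow> ('a, 'e) tvec) set" where
  "vector_fields M U =
     {X. (\<forall>p\<in>U. X p \<in> tangent_space M p) \<and>
         (\<forall>c\<in>atlas M. smooth_fun M (U \<inter> fst c) (\<lambda>p. X p c))}"

definition one_forms ::
  "('a, 'e::euclidean_space) mfd \<Rightarrow> 'a set \<Rightarrow> ('a \<Rightarrow> ('a, 'e) covec) set" where
  "one_forms M U =
     {\<alpha>. (\<forall>p\<in>U. \<alpha> p \<in> cotangent_space M p) \<and>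
         (\<forall>W X. openin (mtop M) W \<and> W \<subseteq> U \<and> X \<in> vector_fields M W
            \<longrightarrow> smooth_fun M W (\<lambda>p. \<alpha> p (X p)))}"

definition pseudo_riemannian_metric ::
  "('a, 'e::euclidean_space) mfd \<Rightarrow> ('a \<Rightarrow> ('a, 'e) tvec \<Rightarrow> ('a, 'e) tvec \<Rightarrow> real) \<Rightarrow> bool" where
  "pseudo_riemannian_metric M g \<longleftrightarrow>
     (\<forall>p\<in>points M.
        bilinear_form (tangent_space M p) (g p) \<and>
        (\<forall>v\<in>tangent_space M p. \<forall>w\<in>tangent_space M p. g p v w = g p w v) \<and>
        (\<forall>v\<in>tangent_space M p. (\<forall>w\<in>tangent_space M p. g p v w = 0) \<longrightarrow> v = (\<lambda>c. 0))) \<and>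
     (\<forall>U X Y. openin (mtop M) U \<and> X \<in> vector_fields M U \<and> Y \<in> vector_fields M U
        \<longrightarrow> smooth_fun M U (\<lambda>p. g p (X p) (Y p)))"

definition bivector_field ::
  "('a, 'e::euclidean_space) mfd \<Rightarrow> ('a \<Rightarrow> ('a, 'e) covec \<Rightarrow> ('a, 'e) covec \<Rightarrow> real) \<Rightarrow> bool" where
  "bivector_field M \<pi> \<longleftrightarrow>
     (\<forall>p\<in>points M.
        bilinear_form (cotangent_space M p) (\<pi> p) \<and>
        (\<forall>\<alpha>\<in>cotangent_space M p. \<forall>\<beta>\<in>cotangent_space M p. \<pi> p \<alpha> \<beta> = - \<pi> p \<beta> \<alpha>)) \<and>
     (\<forall>U \<alpha> \<beta>. openin (mtop M) U \<and> \<alpha> \<in> one_forms M U \<and> \<beta> \<in> one_forms M U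
        \<longrightarrow> smooth_fun M U (\<lambda>p. \<pi> p (\<alpha> p) (\<beta> p)))"

definition sharp ::
  "('a, 'e::euclidean_space) mfd \<Rightarrow> ('a \<Rightarrow> ('a, 'e) covec \<Rightarrow> ('a, 'e) covec \<Rightarrow> real)
    \<Rightarrow> 'a \<Rightarrow> ('a, 'e) covec \<Rightarrow> ('a, 'e) tvec" where
  "sharp M \<pi> p \<alpha> =
     (THE v. v \<in> tangent_space M p \<and> (\<forall>\<beta>\<in>cotangent_space M p. \<beta> v = \<pi> p \<alpha> \<beta>))"


section \<open>The Levi-Civita connection\<close>

text \<open>
  A connection is taken as an operator on smooth vector fields over open subsets that is
  compatible with restriction; every connection on global fields extends to such an operator,
  uniquely up to irrelevant values.  Values of the fields outside the open set are irrelevant.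
\<close>

type_synonym ('a, 'e) conn =
  "('a \<Rightarrow> ('a, 'e) tvec) \<Rightarrow> ('a \<Rightarrow> ('a, 'e) tvec) \<Rightarrow> 'a \<Rightarrow> ('a, 'e) tvec"

definition affine_connection ::
  "('a, 'e::euclidean_space) mfd \<Rightarrow> ('a, 'e) conn \<Rightarrow> bool" where
  "affine_connection M D \<longleftrightarrow>
     (\<forall>U. openin (mtop M) U \<longrightarrow>
        (\<forall>X\<in>vector_fields M U. \<forall>Y\<in>vector_fields M U. D X Y \<in> vector_fields M U) \<and>
        (\<forall>X\<in>vector_fields M U. \<forall>X'\<in>vector_fields M U.
         \<forall>Y\<in>vector_fields M U. \<forall>Y'\<in>vector_fields M U.
           (\<forall>p\<in>U. X p = X' p \<and> Y p = Y' p) \<longrightarrow> (\<forall>p\<in>U. D X Y p = D X' Y' p)) \<and>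
        (\<forall>X\<in>vector_fields M U. \<forall>X'\<in>vector_fields M U. \<forall>Y\<in>vector_fields M U. \<forall>p\<in>U.
           D (\<lambda>q c. X q c + X' q c) Y p = (\<lambda>c. D X Y p c + D X' Y p c)) \<and>
        (\<forall>f. \<forall>X\<in>vector_fields M U. \<forall>Y\<in>vector_fields M U. smooth_fun M U f \<longrightarrow>
           (\<forall>p\<in>U. D (\<lambda>q c. f q *\<^sub>R X q c) Y p = (\<lambda>c. f p *\<^sub>R D X Y p c))) \<and>
        (\<forall>X\<in>vector_fields M U. \<forall>Y\<in>vector_fields M U. \<forall>Y'\<in>vector_fields M U. \<forall>p\<in>U.
           D X (\<lambda>q c. Y q c + Y' q c) p = (\<lambda>c. D X Y p c + D X Y' p c)) \<and>
        (\<forall>f. \<forall>X\<in>vector_fields M U. \<forall>Y\<in>vector_fields M U. smooth_fun M U f \<longrightarrow>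
           (\<forall>p\<in>U. D X (\<lambda>q c. f q *\<^sub>R Y q c) p =
              (\<lambda>c. dirder M f p (X p) *\<^sub>R Y p c + f p *\<^sub>R D X Y p c))))"

text \<open>Torsion-freeness \<open>D X Y - D Y X = [X, Y]\<close> is expressed through the action on functions,
  \<open>[X, Y] \<cdot> f = X \<cdot> (Y \<cdot> f) - Y \<cdot> (X \<cdot> f)\<close>.\<close>

definition torsion_free :: "('a, 'e::euclidean_space) mfd \<Rightarrow> ('a, 'e) conn \<Rightarrow> bool" where
  "torsion_free M D \<longleftrightarrow>
     (\<forall>U X Y. \<forall>f :: 'a \<Rightarrow> real. openin (mtop M) U \<and> X \<in> vector_fields M U \<and>
        Y \<in> vector_fields M U \<and> smooth_fun M U f \<longrightarrow>
        (\<forall>p\<in>U. dirder M f p (D X Y p) - dirder M f p (D Y X p) =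
           dirder M (\<lambda>q. dirder M f q (Y q)) p (X p) - dirder M (\<lambda>q. dirder M f q (X q)) p (Y p)))"

definition metric_connection ::
  "('a, 'e::euclidean_space) mfd \<Rightarrow> ('a \<Rightarrow> ('a, 'e) tvec \<Rightarrow> ('a, 'e) tvec \<Rightarrow> real)
    \<Rightarrow> ('a, 'e) conn \<Rightarrow> bool" where
  "metric_connection M g D \<longleftrightarrow>
     (\<forall>U. \<forall>X\<in>vector_fields M U. \<forall>Y\<in>vector_fields M U. \<forall>Z\<in>vector_fields M U.
        openin (mtop M) U \<longrightarrow>
        (\<forall>p\<in>U. dirder M (\<lambda>q. g q (Y q) (Z q)) p (X p) = g p (D X Y p) (Z p) + g p (Y p) (D X Z p)))"

definition levi_civita_connection ::
  "('a, 'e::euclidean_space) mfd \<Rightarrow> ('a \<Rightarrow> ('a, 'e) tvec \<Rightarrow> ('a, 'e) tvec \<Rightarrow> real)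
    \<Rightarrow> ('a, 'e) conn \<Rightarrow> bool" where
  "levi_civita_connection M g D \<longleftrightarrow>
     affine_connection M D \<and> torsion_free M D \<and> metric_connection M g D"

text \<open>The induced action on 1-forms, \<open>(D\<^sub>X \<beta>)(Y) = X \<cdot> \<beta>(Y) - \<beta>(D\<^sub>X Y)\<close>.\<close>

definition form_connection ::
  "('a, 'e::euclidean_space) mfd \<Rightarrow> ('a, 'e) conn \<Rightarrow> ('a \<Rightarrow> ('a, 'e) tvec)
    \<Rightarrow> ('a \<Rightarrow> ('a, 'e) covec) \<Rightarrow> 'a \<Rightarrow> ('a, 'e) covec" where
  "form_connection M D X \<beta> p =
     (THE \<theta>. \<theta> \<in> cotangent_space M p \<and>
        (\<forall>U Y. openin (mtop M) U \<and> p \<in> U \<and> Y \<in> vector_fields M U \<longrightarrow>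
           \<theta> (Y p) = dirder M (\<lambda>q. \<beta> q (Y q)) p (X p) - \<beta> p (D X Y p)))"

definition pi_compatible ::
  "('a, 'e::euclidean_space) mfd \<Rightarrow> ('a, 'e) conn
    \<Rightarrow> ('a \<Rightarrow> ('a, 'e) covec \<Rightarrow> ('a, 'e) covec \<Rightarrow> real) \<Rightarrow> bool" where
  "pi_compatible M D \<pi> \<longleftrightarrow>
     (\<forall>U. \<forall>\<alpha>\<in>one_forms M U. \<forall>\<beta>\<in>one_forms M U. \<forall>\<gamma>\<in>one_forms M U.
        openin (mtop M) U \<longrightarrow>
        (\<forall>p\<in>U. let X = (\<lambda>q. sharp M \<pi> q (\<alpha> q)) in
           dirder M (\<lambda>q. \<pi> q (\<beta> q) (\<gamma> q)) p (X p)
           - \<pi> p (form_connection M D X \<beta> p) (\<gamma> p)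
           - \<pi> p (\<beta> p) (form_connection M D X \<gamma> p) = 0))"


section \<open>Immersed submanifolds and symplectic leaves\<close>

text \<open>An immersed submanifold of \<open>M\<close> carries its own topology and atlas on a subset of the points
  of \<open>M\<close>; only the inclusion is required to be an (injective) immersion.\<close>

abbreviation incl_map ::
  "('a, 'e::euclidean_space) mfd \<Rightarrow> ('a, 'e) mfd \<Rightarrow> 'a \<Rightarrow> ('a, 'e) tvec \<Rightarrow> ('a, 'e) tvec" where
  "incl_map S M p \<equiv> tangent_map S M id p"

definition immersed_submanifold ::
  "('a, 'e::euclidean_space) mfd \<Rightarrow> ('a, 'e) mfd \<Rightarrow> bool" where
  "immersed_submanifold S M \<longleftrightarrow>
     smooth_manifold S \<and> points S \<subseteq> points M \<and> smooth_map S M id \<and>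
     (\<forall>p\<in>points S. inj_on (incl_map S M p) (tangent_space S p))"

definition sub_tangent_space ::
  "('a, 'e::euclidean_space) mfd \<Rightarrow> ('a, 'e) mfd \<Rightarrow> 'a \<Rightarrow> ('a, 'e) tvec set" where
  "sub_tangent_space S M p = incl_map S M p ` tangent_space S p"

definition integral_manifold ::
  "('a, 'e::euclidean_space) mfd \<Rightarrow> ('a \<Rightarrow> ('a, 'e) covec \<Rightarrow> ('a, 'e) covec \<Rightarrow> real)
    \<Rightarrow> ('a, 'e) mfd \<Rightarrow> bool" where
  "integral_manifold M \<pi> S \<longleftrightarrow>
     immersed_submanifold S M \<and> points S \<noteq> {} \<and> connected_space (mtop S) \<and>
     (\<forall>p\<in>points S. sub_tangent_space S M p = sharp M \<pi> p ` cotangent_space M p)"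

definition symplectic_leaf ::
  "('a, 'e::euclidean_space) mfd \<Rightarrow> ('a \<Rightarrow> ('a, 'e) covec \<Rightarrow> ('a, 'e) covec \<Rightarrow> real)
    \<Rightarrow> ('a, 'e) mfd \<Rightarrow> bool" where
  "symplectic_leaf M \<pi> S \<longleftrightarrow>
     integral_manifold M \<pi> S \<and>
     (\<forall>S'. integral_manifold M \<pi> S' \<and> points S \<subseteq> points S' \<longrightarrow> points S' = points S)"

text \<open>\<open>\<omega>\<^sub>S(#\<alpha>, #\<beta>) = \<pi>(\<alpha>, \<beta>)\<close>, as a form on the intrinsic tangent spaces of the leaf.\<close>

definition leaf_form ::
  "('a, 'e::euclidean_space) mfd \<Rightarrow> ('a \<Rightarrow> ('a, 'e) covec \<Rightarrow> ('a, 'e) covec \<Rightarrow> real)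
    \<Rightarrow> ('a, 'e) mfd \<Rightarrow> 'a \<Rightarrow> ('a, 'e) tvec \<Rightarrow> ('a, 'e) tvec \<Rightarrow> real" where
  "leaf_form M \<pi> S p u v =
     (THE r. \<exists>\<alpha>\<in>cotangent_space M p. \<exists>\<beta>\<in>cotangent_space M p.
        sharp M \<pi> p \<alpha> = incl_map S M p u \<and> sharp M \<pi> p \<beta> = incl_map S M p v \<and> r = \<pi> p \<alpha> \<beta>)"


section \<open>Restriction of the connection to a submanifold\<close>

text \<open>
  The covariant derivative \<open>D\<^sub>X Z\<close> at \<open>p\<close> of a field \<open>Z\<close> along \<open>S\<close> (\<open>Z q\<close> tangent to \<open>M\<close> at \<open>q\<close>, defined
  for \<open>q\<close> in an open subset of \<open>S\<close>) in the direction of a vector field \<open>X\<close> of \<open>S\<close>, i.e. the pullback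
  connection along the inclusion.  In a chart \<open>c\<close> of \<open>M\<close> it is \<open>X \<cdot> Z\<^sub>c + \<Gamma>\<^sub>c(X, Z)\<close>, where the
  Christoffel term \<open>\<Gamma>\<^sub>c(a, b)\<close> is the representative of \<open>D E\<^sub>a E\<^sub>b\<close> for the coordinate fields
  \<open>E\<^sub>a\<close>, \<open>E\<^sub>b\<close> of \<open>c\<close>.  The choice of \<open>c\<close> is immaterial, and if \<open>X\<close> and \<open>Z\<close> extend to fields on an
  open subset of \<open>M\<close>, the result is \<open>D X Z p\<close> for these extensions.
\<close>

definition connection_along ::
  "('a, 'e::euclidean_space) mfd \<Rightarrow> ('a, 'e) mfd \<Rightarrow> ('a, 'e) conn \<Rightarrow> ('a, 'e) conn" where
  "connection_along M S D X Z p =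
     (let c = chart_at M p;
          \<Gamma> = (\<lambda>a b. D (coord_vector M c a) (coord_vector M c b) p c)
      in coord_vector M c
           (dirder S (\<lambda>q. Z q c) p (X p) + \<Gamma> (incl_map S M p (X p) c) (Z p c)) p)"

text \<open>The first conjunct concerns vector fields of (open subsets of) \<open>M\<close> that are tangent to \<open>S\<close> at
  the points of \<open>S\<close>, the second one vector fields of (open subsets of) \<open>S\<close>, which need not extend to
  a neighbourhood of their domain when \<open>S\<close> is not embedded.\<close>

definition totally_geodesic ::
  "('a, 'e::euclidean_space) mfd \<Rightarrow> ('a, 'e) conn \<Rightarrow> ('a, 'e) mfd \<Rightarrow> bool" where
  "totally_geodesic M D S \<longleftrightarrow>
     (\<forall>U. \<forall>X\<in>vector_fields M U. \<forall>Y\<in>vector_fields M U.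
        openin (mtop M) U \<and>
        (\<forall>p\<in>U \<inter> points S. X p \<in> sub_tangent_space S M p \<and> Y p \<in> sub_tangent_space S M p) \<longrightarrow>
        (\<forall>p\<in>U \<inter> points S. D X Y p \<in> sub_tangent_space S M p)) \<and>
     (\<forall>W. \<forall>X\<in>vector_fields S W. \<forall>Y\<in>vector_fields S W.
        openin (mtop S) W \<longrightarrow>
        (\<forall>p\<in>W. connection_along M S D X (\<lambda>q. incl_map S M q (Y q)) p \<in> sub_tangent_space S M p))"

text \<open>The connection on \<open>S\<close> obtained by restricting \<open>D\<close>; meaningful for totally geodesic \<open>S\<close>.\<close>

definition restricted_connection ::
  "('a, 'e::euclidean_space) mfd \<Rightarrow> ('a, 'e) conn \<Rightarrow> ('a, 'e) mfd \<Rightarrow> ('a, 'e) conn" where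
  "restricted_connection M D S X Y p =
     inv_into (tangent_space S p) (incl_map S M p)
       (connection_along M S D X (\<lambda>q. incl_map S M q (Y q)) p)"

definition parallel_two_form ::
  "('a, 'e::euclidean_space) mfd \<Rightarrow> ('a, 'e) conn
    \<Rightarrow> ('a \<Rightarrow> ('a, 'e) tvec \<Rightarrow> ('a, 'e) tvec \<Rightarrow> real) \<Rightarrow> bool" where
  "parallel_two_form S D \<omega> \<longleftrightarrow>
     (\<forall>W. \<forall>X\<in>vector_fields S W. \<forall>Y\<in>vector_fields S W. \<forall>Z\<in>vector_fields S W.
        openin (mtop S) W \<longrightarrow>
        (\<forall>p\<in>W. dirder S (\<lambda>q. \<omega> q (Y q) (Z q)) p (X p)
               - \<omega> p (D X Y p) (Z p) - \<omega> p (Y p) (D X Z p) = 0))"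

end

theory Submission
  imports Defs
begin

text \<open>
  In a chart of \<open>M\<close> the anchor map \<open>#\<close> becomes a family \<open>P q\<close> of skew operators whose range at a
  point of the leaf \<open>S\<close> is the tangent space of \<open>S\<close>; in particular the rank of \<open>P\<close> is constant along
  \<open>S\<close>.  Compatibility says that \<open>D\<^sub>X (P e)\<close> lies in the range of \<open>P\<close> for constant \<open>e\<close> and
  \<open>X\<close> tangent to \<open>S\<close>, and computes the derivative of \<open>\<pi>(e, f) = f \<bullet> P e\<close>.  A field \<open>Y\<close> along \<open>S\<close>
  with \<open>Y q \<in> range (P q)\<close> is compared at a fixed point \<open>p\<close> with \<open>P e\<close>, where \<open>Y p = P p e\<close>.
  Constant rank yields preimages \<open>P q (k q) = Y q - P q e\<close> with \<open>k q = O(|q - p|)\<close>.  Hence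
  \<open>Y - P e\<close> agrees to first order with the range of \<open>P p\<close>, so that \<open>D\<^sub>X Y\<close> is tangent to \<open>S\<close>, and in
  \<open>\<omega>(Y, Z)\<close> the term quadratic in the remainders does not contribute to the derivative at \<open>p\<close>, so
  no smooth lift of \<open>Y\<close> to a field of covectors is needed.
\<close>

section \<open>Calculus within a linear subspace\<close>

text \<open>The rank of \<open>P\<close> may jump off the leaf, and a field on \<open>S\<close> need
  not extend to \<open>M\<close> when \<open>S\<close> is not embedded; all derivatives are
  therefore taken in a chart of the leaf itself. The bound on \<open>k q\<close> rests on skewness.
  The operator \<open>P p\<close> is injective on its own range \<open>R\<close>, hence bounded
  below there, and nearby \<open>P q\<close> keep half of this bound. Equal rank then makes
  \<open>P q\<close> map \<open>R\<close> onto \<open>range (P q)\<close>, so preimages can be taken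
  in the fixed space \<open>R\<close>. First-order agreement is tested on the orthogonal complement
  of \<open>R\<close>, which is the kernel of \<open>P p\<close>: for \<open>c\<close> in it,
  \<open>c \<bullet> P q (k q) = - (k q \<bullet> P q c)\<close> is a factor of order
  \<open>|q - p|\<close> times a factor tending to 0. Since model spaces are subspaces
  \<open>V\<close>, a derivative within \<open>V\<close> is determined only on \<open>V\<close>;
  this causes the recurring side condition that directions lie in the model space.\<close>

lemma eventually_in_openin_subspace:
  assumes "openin (top_of_set V) A" "x \<in> A"
  shows "eventually (\<lambda>y. y \<in> A) (at x within V)"
  using assms by (auto simp: openin_open eventually_at_topological)

text \<open>The line through \<open>x\<close> in direction \<open>v\<close> stays in
  \<open>V\<close>, so restricting \<open>f\<close> to it reduces the claim to uniqueness for
  functions of one real variable. Off \<open>V\<close> two derivatives may differ.\<close>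

lemma has_derivative_within_subspace_unique:
  assumes V: "subspace V" "x \<in> V" "v \<in> V"
    and f: "(f has_derivative f') (at x within V)" "(f has_derivative f'') (at x within V)"
  shows "f' v = f'' v"
proof -
  have l: "((\<lambda>t::real. x + t *\<^sub>R v) has_derivative (\<lambda>t. t *\<^sub>R v)) (at 0 within UNIV)"
    by (auto intro!: derivative_eq_intros)
  have sub: "range (\<lambda>t::real. x + t *\<^sub>R v) \<subseteq> V"
    using V by (auto intro!: subspace_add subspace_scale)
  have *: "((\<lambda>t. f (x + t *\<^sub>R v)) has_derivative (\<lambda>t. h (t *\<^sub>R v))) (at 0)"
    if "(f has_derivative h) (at x within V)" for h
    using has_derivative_in_compose[OF l, of f h] has_derivative_subset[OF _ sub, of f h x] that
    by simp
  show ?thesis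
    using fun_cong[OF has_derivative_unique[OF *[OF f(1)] *[OF f(2)]], of 1] by simp
qed

lemma frechet_derivative_within_subspace:
  assumes "subspace V" "x \<in> V" "v \<in> V" "(f has_derivative f') (at x within V)"
  shows "frechet_derivative f (at x within V) v = f' v"
  using assms(4) frechet_derivative_works[of f "at x within V"] differentiableI[OF assms(4)]
  by (intro has_derivative_within_subspace_unique[OF assms(1-3)]) auto

lemma has_derivative_transform_openin:
  assumes "openin (top_of_set V) A" "x \<in> A" "\<And>y. y \<in> A \<Longrightarrow> f y = g y"
    "(f has_derivative f') (at x within V)"
  shows "(g has_derivative f') (at x within V)"
proof (rule has_derivative_transform_eventually[OF assms(4)])
  show "\<forall>\<^sub>F y in at x within V. f y = g y"
    using eventually_in_openin_subspace[OF assms(1,2)] by eventually_elim (use assms in auto)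
  show "x \<in> V" using assms openin_imp_subset by blast
qed (use assms in auto)

lemma at_within_openin_subspace:
  assumes "openin (top_of_set V) A" "x \<in> A"
  shows "at x within A = at x within V"
proof -
  obtain T where "open T" "A = V \<inter> T" using assms(1) by (auto simp: openin_open)
  then show ?thesis using assms(2) by (intro at_within_nhd[of x T]) auto
qed

lemma has_derivative_compose_openin:
  assumes A: "openin (top_of_set V) A" "x \<in> A"
    and f: "(f has_derivative f') (at x within V)" "f ` A \<subseteq> W"
    and g: "(g has_derivative g') (at (f x) within W)"
  shows "((\<lambda>x. g (f x)) has_derivative (\<lambda>v. g' (f' v))) (at x within V)"
  using has_derivative_in_compose[of f f' x A g g'] has_derivative_subset[OF g f(2)] f(1)
  by (simp add: at_within_openin_subspace[OF A])

lemma frechet_derivative_cong_openin: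
  assumes "subspace V" "openin (top_of_set V) A" "x \<in> A" "v \<in> V" "\<And>y. y \<in> A \<Longrightarrow> f y = g y"
    "f differentiable (at x within V)"
  shows "frechet_derivative g (at x within V) v = frechet_derivative f (at x within V) v"
proof -
  have "x \<in> V" using assms openin_imp_subset by blast
  have "(f has_derivative frechet_derivative f (at x within V)) (at x within V)"
    using assms(6) frechet_derivative_works by blast
  from has_derivative_transform_openin[OF assms(2,3,5) this]
  show ?thesis by (rule frechet_derivative_within_subspace[OF assms(1) \<open>x \<in> V\<close> assms(4)])
qed

text \<open>Tested by duality: for \<open>w\<close> orthogonal to \<open>W\<close> the function
  \<open>inner w (f y)\<close> vanishes near \<open>x\<close>, so its derivative vanishes in the
  directions of \<open>V\<close>, and \<open>W\<close> is its own double orthogonal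
  complement.\<close>

lemma has_derivative_mem_subspace:
  fixes f :: "'c::real_normed_vector \<Rightarrow> 'd::euclidean_space"
  assumes V: "subspace V" "x \<in> V" "v \<in> V" and W: "subspace W"
    and f: "(f has_derivative f') (at x within V)"
    and ev: "eventually (\<lambda>y. f y \<in> W) (at x within V)" "f x \<in> W"
  shows "f' v \<in> W"
proof -
  have "inner w (f' v) = 0" if w: "\<And>u. u \<in> W \<Longrightarrow> inner w u = 0" for w
  proof -
    have 1: "((\<lambda>y. inner w (f y)) has_derivative (\<lambda>v. inner w (f' v))) (at x within V)"
      using f by (auto intro!: derivative_eq_intros)
    have "((\<lambda>y. 0) has_derivative (\<lambda>v. inner w (f' v))) (at x within V)"
    proof (rule has_derivative_transform_eventually[OF 1])
      show "\<forall>\<^sub>F y in at x within V. inner w (f y) = 0"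
        using ev(1) by eventually_elim (rule w)
    qed (use V w ev in auto)
    from has_derivative_within_subspace_unique[OF V this has_derivative_const] show ?thesis .
  qed
  moreover obtain y z where yz: "y \<in> W" "\<And>u. u \<in> W \<Longrightarrow> orthogonal z u" "f' v = y + z"
    using orthogonal_subspace_decomp_exists[of W "f' v"] span_eq_iff[of W] W by metis
  ultimately have "inner z (f' v) = 0" by (simp add: orthogonal_def)
  then have "inner z z = 0" using yz by (simp add: orthogonal_def inner_right_distrib)
  then show ?thesis using yz by simp
qed

section \<open>Orthonormal expansions in a subspace\<close>

lemma orthonormal_expansion:
  fixes y :: "'d::euclidean_space"
  assumes B: "finite B" "pairwise orthogonal B" "\<And>b. b \<in> B \<Longrightarrow> norm b = 1" and y: "y \<in> span B"
  shows "(\<Sum>b\<in>B. inner b y *\<^sub>R b) = y"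
  using y
proof (induction rule: span_induct_alt)
  case (step r x y)
  have "(\<Sum>b\<in>B. inner b x *\<^sub>R b) = (\<Sum>b\<in>B. if b = x then b else 0)"
    using B(2,3) step(1) by (intro sum.cong) (auto simp: pairwise_def orthogonal_def dot_square_norm)
  with step B(1) show ?case
    by (simp add: inner_right_distrib scaleR_left_distrib sum.distrib flip: scaleR_scaleR scaleR_right.sum)
qed simp

text \<open>The expansion formula makes the coordinates of \<open>V\<close> restrictions of the
  bounded linear maps \<open>inner b\<close>, so coordinates of a smooth function are smooth at
  once.\<close>

definition onb :: "'e::euclidean_space set \<Rightarrow> 'e set" where
  "onb V = (SOME B. finite B \<and> B \<subseteq> V \<and> (\<forall>y\<in>V. (\<Sum>b\<in>B. inner b y *\<^sub>R b) = y))"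

lemma onb:
  assumes "subspace V"
  shows finite_onb: "finite (onb V)" and onb_subset: "onb V \<subseteq> V"
    and onb_expansion: "y \<in> V \<Longrightarrow> (\<Sum>b\<in>onb V. inner b y *\<^sub>R b) = y"
proof -
  obtain B where B: "B \<subseteq> V" "pairwise orthogonal B" "\<And>x. x \<in> B \<Longrightarrow> norm x = 1"
     "independent B" "span B = V"
    using orthonormal_basis_subspace[OF assms] by metis
  have "finite B" using B(4) independent_imp_finite by blast
  with B orthonormal_expansion[OF \<open>finite B\<close> B(2,3)]
  have "\<exists>B. finite B \<and> B \<subseteq> V \<and> (\<forall>y\<in>V. (\<Sum>b\<in>B. inner b y *\<^sub>R b) = y)" by blast
  from someI_ex[OF this, folded onb_def]
  show "finite (onb V)" "onb V \<subseteq> V" "y \<in> V \<Longrightarrow> (\<Sum>b\<in>onb V. inner b y *\<^sub>R b) = y" by auto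
qed

section \<open>Functions of class \<open>C\<^sup>k\<close>\<close>

lemma Ck_on_subset:
  "Ck_on k V A f \<Longrightarrow> A' \<subseteq> A \<Longrightarrow> Ck_on k V A' f"
  by (induction k arbitrary: f) (auto intro: continuous_on_subset)

lemma Ck_on_cong:
  assumes V: "subspace V" "openin (top_of_set V) A"
  shows "Ck_on k V A f \<Longrightarrow> (\<And>x. x \<in> A \<Longrightarrow> f x = g x) \<Longrightarrow> Ck_on k V A g"
proof (induction k arbitrary: f g)
  case 0
  then show ?case by (auto cong: continuous_on_cong)
next
  case (Suc k)
  show ?case unfolding Ck_on.simps
  proof (intro conjI ballI)
    fix x assume "x \<in> A"
    with Suc.prems show "g differentiable (at x within V)"
      using has_derivative_transform_openin[OF V(2) \<open>x \<in> A\<close>, of f g]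
      unfolding differentiable_def Ck_on.simps by metis
  next
    fix v assume v: "v \<in> V"
    with Suc.prems have "Ck_on k V A (\<lambda>x. frechet_derivative f (at x within V) v)" by auto
    then show "Ck_on k V A (\<lambda>x. frechet_derivative g (at x within V) v)"
    proof (rule Suc.IH)
      fix x assume x: "x \<in> A"
      show "frechet_derivative f (at x within V) v = frechet_derivative g (at x within V) v"
        by (rule sym, rule frechet_derivative_cong_openin[OF V x v]) (use Suc.prems x in auto)
    qed
  qed
qed

text \<open>Allows an explicit derivative \<open>f'\<close> produced by differentiation rules; it
  agrees with \<open>frechet_derivative\<close> on \<open>V\<close>, the only directions that
  \<open>Ck_on\<close> inspects.\<close>

lemma Ck_on_SucI:
  assumes V: "subspace V" "openin (top_of_set V) A"
    and der: "\<And>x. x \<in> A \<Longrightarrow> (f has_derivative f' x) (at x within V)"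
    and Ck: "\<And>v. v \<in> V \<Longrightarrow> Ck_on k V A (\<lambda>x. f' x v)"
  shows "Ck_on (Suc k) V A f"
  unfolding Ck_on.simps
proof (intro conjI ballI)
  fix v assume v: "v \<in> V"
  show "Ck_on k V A (\<lambda>x. frechet_derivative f (at x within V) v)"
  proof (rule Ck_on_cong[OF V Ck[OF v]])
    fix x assume "x \<in> A"
    moreover then have "x \<in> V" using V openin_imp_subset by blast
    ultimately show "f' x v = frechet_derivative f (at x within V) v"
      using frechet_derivative_within_subspace[OF V(1) _ v der] by simp
  qed
qed (use der differentiableI in blast)

lemma Ck_on_SucD:
  assumes "Ck_on (Suc k) V A f" "x \<in> A"
  shows "(f has_derivative frechet_derivative f (at x within V)) (at x within V)"
  using assms frechet_derivative_works by auto

lemma Ck_on_Suc_imp: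
  assumes V: "openin (top_of_set V) A"
  shows "Ck_on (Suc k) V A f \<Longrightarrow> Ck_on k V A f"
proof (induction k arbitrary: f)
  case 0
  have "A \<subseteq> V" using V openin_imp_subset by blast
  with 0 show ?case
    by (auto simp: continuous_on_eq_continuous_within
        intro!: continuous_within_subset[OF differentiable_imp_continuous_within])
qed auto

context
  fixes V A :: "'e::euclidean_space set"
  assumes V: "subspace V" "openin (top_of_set V) A"
begin

lemma Ck_on_const: "Ck_on k V A (\<lambda>x. w)"
proof (induction k arbitrary: w)
  case (Suc k)
  show ?case by (rule Ck_on_SucI[OF V has_derivative_const]) (rule Suc)
qed auto

lemma Ck_on_linear:
  assumes L: "bounded_linear L"
  shows "Ck_on k V A f \<Longrightarrow> Ck_on k V A (\<lambda>x. L (f x))"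
proof (induction k arbitrary: f)
  case 0
  then show ?case by (auto intro: bounded_linear.continuous_on[OF L])
next
  case (Suc k)
  show ?case
  proof (rule Ck_on_SucI[OF V bounded_linear.has_derivative[OF L Ck_on_SucD[OF Suc.prems]]])
    fix v assume "v \<in> V"
    with Suc show "Ck_on k V A (\<lambda>x. L (frechet_derivative f (at x within V) v))" by auto
  qed
qed

lemma Ck_on_add:
  "Ck_on k V A f \<Longrightarrow> Ck_on k V A g \<Longrightarrow> Ck_on k V A (\<lambda>x. f x + g x)"
proof (induction k arbitrary: f g)
  case 0
  then show ?case by (auto intro: continuous_on_add)
next
  case (Suc k)
  show ?case
  proof (rule Ck_on_SucI[OF V has_derivative_add[OF Ck_on_SucD[OF Suc.prems(1)] Ck_on_SucD[OF Suc.prems(2)]]])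
    fix v assume "v \<in> V"
    with Suc show "Ck_on k V A (\<lambda>x. frechet_derivative f (at x within V) v
        + frechet_derivative g (at x within V) v)" by auto
  qed
qed

lemma Ck_on_sum:
  "finite I \<Longrightarrow> (\<And>i. i \<in> I \<Longrightarrow> Ck_on k V A (f i)) \<Longrightarrow> Ck_on k V A (\<lambda>x. \<Sum>i\<in>I. f i x)"
  by (induction I rule: finite_induct) (auto intro: Ck_on_const Ck_on_add)

lemma Ck_on_scaleR:
  fixes f :: "'e \<Rightarrow> real" and g :: "'e \<Rightarrow> 'b::real_normed_vector"
  shows "Ck_on k V A f \<Longrightarrow> Ck_on k V A g \<Longrightarrow> Ck_on k V A (\<lambda>x. f x *\<^sub>R g x)"
proof (induction k arbitrary: f g)
  case 0
  then show ?case by (auto intro: continuous_on_scaleR)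
next
  case (Suc k)
  note le = Suc.prems[THEN Ck_on_Suc_imp[OF V(2)]]
  show ?case
  proof (rule Ck_on_SucI[OF V has_derivative_scaleR[OF Ck_on_SucD[OF Suc.prems(1)] Ck_on_SucD[OF Suc.prems(2)]]])
    fix v assume "v \<in> V"
    with Suc.prems show "Ck_on k V A (\<lambda>x. f x *\<^sub>R frechet_derivative g (at x within V) v
        + frechet_derivative f (at x within V) v *\<^sub>R g x)"
      by (intro Ck_on_add Suc.IH) (auto intro: le)
  qed
qed

text \<open>In the chain rule the derivative of \<open>g\<close> is applied to a direction that
  varies with \<open>x\<close>, whereas \<open>Ck_on\<close> speaks of fixed directions. The
  direction lies in \<open>W\<close>, so it is expanded in \<open>onb W\<close>, and the product
  rule and the induction hypothesis for each fixed \<open>b\<close> apply.\<close>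

lemma Ck_on_compose:
  fixes f :: "'e \<Rightarrow> 'f::euclidean_space" and g :: "'f \<Rightarrow> 'b::real_normed_vector"
  assumes W: "subspace W" "openin (top_of_set W) A'" and fA: "f ` A \<subseteq> A'"
  shows "Ck_on k V A f \<Longrightarrow> Ck_on k W A' g \<Longrightarrow> Ck_on k V A (\<lambda>x. g (f x))"
proof (induction k arbitrary: g)
  case 0
  then show ?case using fA by (auto intro: continuous_on_compose2)
next
  case (Suc k)
  have AV: "A \<subseteq> V" and AW: "A' \<subseteq> W" using V W openin_imp_subset by blast+
  let ?f' = "\<lambda>x. frechet_derivative f (at x within V)"
  let ?g' = "\<lambda>y. frechet_derivative g (at y within W)"
  have f'W: "?f' x v \<in> W" if "x \<in> A" "v \<in> V" for x v
    using eventually_in_openin_subspace[OF V(2) \<open>x \<in> A\<close>] AV AW fA that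
    by (intro has_derivative_mem_subspace[OF V(1) _ _ W(1) Ck_on_SucD[OF Suc.prems(1)]])
       (auto elim!: eventually_mono)
  have der: "((\<lambda>x. g (f x)) has_derivative (\<lambda>v. ?g' (f x) (?f' x v))) (at x within V)" if "x \<in> A" for x
    using fA AW that by (intro has_derivative_compose_openin[OF V(2) that
        Ck_on_SucD[OF Suc.prems(1) that] _ Ck_on_SucD[OF Suc.prems(2)]]) auto
  show ?case
  proof (rule Ck_on_SucI[OF V der])
    fix v assume v: "v \<in> V"
    have "Ck_on k V A (\<lambda>x. \<Sum>b\<in>onb W. inner b (?f' x v) *\<^sub>R ?g' (f x) b)"
    proof (intro Ck_on_sum Ck_on_scaleR finite_onb[OF W(1)])
      fix b assume b: "b \<in> onb W"
      show "Ck_on k V A (\<lambda>x. inner b (?f' x v))"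
        by (rule Ck_on_linear[OF bounded_linear_inner_right]) (use Suc.prems v in auto)
      show "Ck_on k V A (\<lambda>x. ?g' (f x) b)"
        using Suc.prems(2) b onb_subset[OF W(1)]
        by (intro Suc.IH Ck_on_Suc_imp[OF V(2) Suc.prems(1)]) auto
    qed
    then show "Ck_on k V A (\<lambda>x. ?g' (f x) (?f' x v))"
    proof (rule Ck_on_cong[OF V])
      fix x assume x: "x \<in> A"
      then have "f x \<in> A'" using fA by blast
      interpret g': bounded_linear "?g' (f x)"
        by (rule has_derivative_bounded_linear[OF Ck_on_SucD[OF Suc.prems(2) \<open>f x \<in> A'\<close>]])
      have "?g' (f x) (?f' x v) = ?g' (f x) (\<Sum>b\<in>onb W. inner b (?f' x v) *\<^sub>R b)"
        using onb_expansion[OF W(1) f'W[OF x v]] by simp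
      then show "(\<Sum>b\<in>onb W. inner b (?f' x v) *\<^sub>R ?g' (f x) b) = ?g' (f x) (?f' x v)"
        by (simp add: g'.sum g'.scaleR)
    qed
  qed
qed

end

lemma smooth_on_subset: "smooth_on V A f \<Longrightarrow> A' \<subseteq> A \<Longrightarrow> smooth_on V A' f"
  by (auto simp: smooth_on_def intro: Ck_on_subset)

lemma smooth_onD:
  assumes "smooth_on V A f" "x \<in> A"
  shows "(f has_derivative frechet_derivative f (at x within V)) (at x within V)"
  using assms(1) unfolding smooth_on_def by (intro Ck_on_SucD[OF _ assms(2)]) blast

lemma smooth_on_frechet_derivative:
  "smooth_on V A f \<Longrightarrow> v \<in> V \<Longrightarrow> smooth_on V A (\<lambda>x. frechet_derivative f (at x within V) v)"
  unfolding smooth_on_def using Ck_on.simps(2) by blast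

section \<open>Skew-symmetric operators of constant rank\<close>

text \<open>The coordinate form of a bivector. What matters below is that the range of such an
  operator is the orthogonal complement of its kernel.\<close>

definition skew :: "('e::euclidean_space \<Rightarrow> 'e) \<Rightarrow> bool" where
  "skew P \<longleftrightarrow> linear P \<and> (\<forall>a b. inner a (P b) = - inner b (P a))"

lemma has_derivative_zero_of_bound:
  fixes r :: "'c::real_normed_vector \<Rightarrow> 'b::real_normed_vector"
  assumes "\<forall>\<^sub>F s in at s0 within A. norm (r s) \<le> h s * norm (s - s0)"
    and "(h \<longlongrightarrow> 0) (at s0 within A)" and "r s0 = 0"
  shows "(r has_derivative (\<lambda>_. 0)) (at s0 within A)"
  unfolding has_derivative_within
proof (intro conjI)
  show "((\<lambda>y. (1 / norm (y - s0)) *\<^sub>R (r y - (r s0 + 0))) \<longlongrightarrow> 0) (at s0 within A)"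
  proof (rule Lim_null_comparison[OF _ assms(2)])
    show "\<forall>\<^sub>F y in at s0 within A. norm ((1 / norm (y - s0)) *\<^sub>R (r y - (r s0 + 0))) \<le> h y"
      using assms(1) eventually_neq_at_within[of s0 s0 A]
    proof eventually_elim
      case (elim y)
      then show ?case by (simp add: assms(3) divide_simps mult.commute)
    qed
  qed
qed simp

text \<open>A bound on preimages that is uniform in \<open>s\<close>, although the ranges move: all
  preimages are taken in the fixed space \<open>range P0\<close>, on which the operators
  \<open>P s\<close> near \<open>P0\<close> are uniformly bounded below.\<close>

lemma skew_constant_rank_preimage_bound:
  fixes P :: "'c::real_normed_vector \<Rightarrow> 'e::euclidean_space \<Rightarrow> 'e"
  assumes sk: "\<forall>\<^sub>F s in F. skew (P s)" and sk0: "skew P0"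
    and lim: "\<And>a. ((\<lambda>s. P s a) \<longlongrightarrow> P0 a) F"
    and rank: "\<forall>\<^sub>F s in F. dim (range (P s)) = dim (range P0)"
  obtains C where "C > 0"
    "\<forall>\<^sub>F s in F. \<forall>u\<in>range (P s). \<exists>k. P s k = u \<and> norm k \<le> C * norm u"
proof -
  define R where "R = range P0"
  have lin0: "linear P0" using sk0 by (simp add: skew_def)
  have R: "subspace R" unfolding R_def by (rule linear_subspace_image[OF lin0]) simp
  \<comment> \<open>Skewness gives
    \<open>inner x x = inner x (P0 y) = - inner y (P0 x) = 0\<close>.\<close>
  have inj: "x = 0" if x: "x \<in> R" "P0 x = 0" for x
  proof -
    obtain y where y: "x = P0 y" using x by (auto simp: R_def)
    have "inner x (P0 y) = - inner y (P0 x)" using sk0 unfolding skew_def by blast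
    with x y show "x = 0" by simp
  qed
  obtain e where e: "e > 0" "\<And>x. x \<in> R \<Longrightarrow> norm (P0 x) \<ge> e * norm x"
    using injective_imp_isometric[OF closed_subspace[OF R] R, of P0] inj lin0
      linear_conv_bounded_linear by metis
  \<comment> \<open>This finite sum dominates the operator norm of \<open>P s - P0\<close>, so
    pointwise convergence becomes uniform. The threshold \<open>e / 2\<close> leaves half of the
    lower bound \<open>e\<close> of \<open>P0\<close>, whence the constant
    \<open>2 / e\<close>.\<close>
  have "((\<lambda>s. \<Sum>i\<in>Basis. norm (P s i - P0 i)) \<longlongrightarrow> (\<Sum>i\<in>Basis. norm (P0 i - P0 i))) F"
    by (intro tendsto_intros lim)
  then have "\<forall>\<^sub>F s in F. (\<Sum>i\<in>Basis. norm (P s i - P0 i)) < e / 2"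
    using e by (intro order_tendstoD) auto
  with sk rank have "\<forall>\<^sub>F s in F. \<forall>u\<in>range (P s). \<exists>k. P s k = u \<and> norm k \<le> 2 / e * norm u"
  proof eventually_elim
    case (elim s)
    have lin: "linear (P s)" using elim by (simp add: skew_def)
    have d: "norm (P s x - P0 x) \<le> e / 2 * norm x" for x
    proof -
      have "P s x - P0 x = (\<Sum>i\<in>Basis. inner x i *\<^sub>R (P s i - P0 i))"
        by (subst (1 2) euclidean_representation[of x, symmetric])
           (simp add: linear_sum[OF lin] linear_sum[OF lin0] linear_scale[OF lin]
             linear_scale[OF lin0] scaleR_diff_right sum_subtractf)
      also have "norm \<dots> \<le> (\<Sum>i\<in>Basis. norm x * norm (P s i - P0 i))"
        by (rule sum_norm_le) (auto intro!: mult_right_mono Basis_le_norm)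
      also have "\<dots> = norm x * (\<Sum>i\<in>Basis. norm (P s i - P0 i))" by (simp add: sum_distrib_left)
      also have "\<dots> \<le> norm x * (e / 2)" using elim by (intro mult_left_mono) auto
      finally show ?thesis by (simp add: mult.commute)
    qed
    have low: "e / 2 * norm x \<le> norm (P s x)" if "x \<in> R" for x
      using d[of x] e(2)[OF that] norm_triangle_ineq2[of "P0 x" "P s x"]
      by (simp add: norm_minus_commute)
    have "inj_on (P s) R"
    proof (rule linear_inj_on_iff_eq_0[OF lin R, THEN iffD2], intro ballI impI)
      fix x assume "x \<in> R" "P s x = 0"
      then show "x = 0" using low[of x] e(1) by (auto simp: mult_le_0_iff)
    qed
    then have "dim (P s ` R) = dim R"
      using dim_image_eq[OF lin, of R] R by (simp add: span_eq_iff[THEN iffD2])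
    \<comment> \<open>The place where constant rank enters: the image of \<open>R\<close> already
      has the dimension of the whole range.\<close>
    then have "P s ` R = range (P s)"
      using elim by (intro subspace_dim_equal linear_subspace_image[OF lin] R) (auto simp: R_def)
    show ?case
    proof
      fix u assume "u \<in> range (P s)"
      then obtain k where k: "k \<in> R" "u = P s k" using \<open>P s ` R = range (P s)\<close> by auto
      with low[OF k(1)] e(1) show "\<exists>k. P s k = u \<and> norm k \<le> 2 / e * norm u"
        by (intro exI[of _ k]) (auto simp: field_simps)
    qed
  qed
  with e that[of "2 / e"] show ?thesis by auto
qed

section \<open>Fields with values in the ranges of a skew family\<close>

lemma has_derivative_linear_growth:
  fixes f :: "'c::real_normed_vector \<Rightarrow> 'b::real_normed_vector"
  assumes "(f has_derivative f') (at x within A)"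
  obtains K where "K > 0" "\<forall>\<^sub>F y in at x within A. norm (f y - f x) \<le> K * norm (y - x)"
proof -
  have bl: "bounded_linear f'" using assms has_derivative_bounded_linear by blast
  then obtain K where K: "K > 0" "\<And>v. norm (f' v) \<le> norm v * K"
    using bounded_linear.pos_bounded by metis
  obtain d where d: "d > 0" "\<And>y. y \<in> A \<Longrightarrow> norm (y - x) < d \<Longrightarrow>
      norm (f y - f x - f' (y - x)) \<le> 1 * norm (y - x)"
    using assms unfolding has_derivative_within_alt by (meson zero_less_one)
  \<comment> \<open>\<open>K\<close> bounds the linear part; the added 1 absorbs the remainder,
    estimated with epsilon 1.\<close>
  have "\<forall>\<^sub>F y in at x within A. norm (f y - f x) \<le> (K + 1) * norm (y - x)"
    unfolding eventually_at
  proof (intro exI[of _ d] conjI ballI impI)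
    fix y assume "y \<in> A" "y \<noteq> x \<and> dist y x < d"
    with d(2)[of y] K(2)[of "y - x"] norm_triangle_ineq[of "f y - f x - f' (y - x)" "f' (y - x)"]
    show "norm (f y - f x) \<le> (K + 1) * norm (y - x)" by (simp add: dist_norm algebra_simps)
  qed (use d in auto)
  with K that[of "K + 1"] show ?thesis by auto
qed

text \<open>Abstracts the anchor map read along the leaf: \<open>s\<close> is a coordinate on the
  leaf and \<open>P' a\<close> the derivative of \<open>P s a\<close>. Differentiability is assumed
  at the single point \<open>s0\<close>, skewness and equal rank at nearby points.\<close>

locale skew_family =
  fixes V :: "'c::real_normed_vector set" and s0 :: 'c
    and P :: "'c \<Rightarrow> 'e::euclidean_space \<Rightarrow> 'e" and P' :: "'e \<Rightarrow> 'c \<Rightarrow> 'e"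
  assumes V: "subspace V" "s0 \<in> V"
    and skew: "\<forall>\<^sub>F s in at s0 within V. skew (P s)" "skew (P s0)"
    and der: "\<And>a. ((\<lambda>s. P s a) has_derivative P' a) (at s0 within V)"
    and rank: "\<forall>\<^sub>F s in at s0 within V. dim (range (P s)) = dim (range (P s0))"
begin

lemma lim: "((\<lambda>s. P s a) \<longlongrightarrow> P s0 a) (at s0 within V)"
  using has_derivative_continuous[OF der] by (simp add: continuous_within)

text \<open>\<open>Y - P e\<close> vanishes at \<open>s0\<close> and is differentiable there, so it
  grows at most linearly, and the uniform preimage bound passes this on to \<open>k\<close>.\<close>

lemma preimage_growth:
  assumes Y: "(Y has_derivative Y') (at s0 within V)"
    "\<forall>\<^sub>F s in at s0 within V. Y s \<in> range (P s)" and e: "Y s0 = P s0 e"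
  obtains k K where "K > 0" "\<forall>\<^sub>F s in at s0 within V. P s (k s) = Y s - P s e \<and>
     norm (k s) \<le> K * norm (s - s0) \<and> norm (Y s - P s e) \<le> K * norm (s - s0)"
proof -
  obtain C where C: "C > 0"
    "\<forall>\<^sub>F s in at s0 within V. \<forall>u\<in>range (P s). \<exists>k. P s k = u \<and> norm k \<le> C * norm u"
    by (rule skew_constant_rank_preimage_bound[OF skew lim rank])
  obtain L where L: "L > 0" "\<forall>\<^sub>F s in at s0 within V. norm (Y s - P s e) \<le> L * norm (s - s0)"
    using e by (rule_tac has_derivative_linear_growth[OF has_derivative_diff[OF Y(1) der[of e]]]) simp
  \<comment> \<open>Chosen separately for each \<open>s\<close>: no continuity of \<open>k\<close>
    is available, only its size is controlled.\<close>
  define k where "k s = (SOME k. P s k = Y s - P s e \<and> norm k \<le> C * norm (Y s - P s e))" for s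
  \<comment> \<open>One constant for both estimates: \<open>C * L\<close> serves \<open>k s\<close>
    and \<open>L\<close> serves \<open>Y s - P s e\<close>.\<close>
  let ?K = "C * L + L"
  have "\<forall>\<^sub>F s in at s0 within V. P s (k s) = Y s - P s e \<and>
     norm (k s) \<le> ?K * norm (s - s0) \<and> norm (Y s - P s e) \<le> ?K * norm (s - s0)"
    using C(2) L(2) Y(2) skew(1)
  proof eventually_elim
    case (elim s)
    have "Y s - P s e \<in> range (P s)"
      using elim linear_subspace_image[of "P s" UNIV] by (auto simp: skew_def intro: subspace_diff)
    then have "\<exists>k. P s k = Y s - P s e \<and> norm k \<le> C * norm (Y s - P s e)" using elim by blast
    from someI_ex[OF this, folded k_def]
    have k: "P s (k s) = Y s - P s e" "norm (k s) \<le> C * norm (Y s - P s e)" by auto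
    have "C * norm (Y s - P s e) \<le> C * (L * norm (s - s0))" using elim C by (intro mult_left_mono) auto
    moreover have "0 \<le> L * norm (s - s0)" "0 \<le> C * (L * norm (s - s0))" using L C by auto
    moreover have "?K * norm (s - s0) = C * (L * norm (s - s0)) + L * norm (s - s0)"
      by (simp add: algebra_simps)
    ultimately show ?case using k elim by linarith
  qed
  moreover have "?K > 0" using C L by (simp add: add_pos_pos)
  ultimately show ?thesis using that by blast
qed

text \<open>For \<open>c\<close> orthogonal to \<open>range (P s0)\<close>, moving
  \<open>P s\<close> to the other side turns \<open>inner c (Y s - P s e)\<close> into
  \<open>- inner (k s) (P s c)\<close>. Here \<open>k s\<close> is of first order and
  \<open>P s c\<close> tends to 0, so the derivative of this component is zero.\<close>

lemma derivative_diff_in_range: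
  assumes Y: "(Y has_derivative Y') (at s0 within V)"
    "\<forall>\<^sub>F s in at s0 within V. Y s \<in> range (P s)" and e: "Y s0 = P s0 e" and x: "x \<in> V"
  shows "Y' x - P' e x \<in> range (P s0)"
proof -
  obtain k K where k: "K > 0" "\<forall>\<^sub>F s in at s0 within V. P s (k s) = Y s - P s e \<and>
     norm (k s) \<le> K * norm (s - s0) \<and> norm (Y s - P s e) \<le> K * norm (s - s0)"
    by (rule preimage_growth[OF Y e])
  let ?R = "range (P s0)"
  have lin0: "linear (P s0)" using skew by (simp add: skew_def)
  have R: "subspace ?R" by (rule linear_subspace_image[OF lin0]) simp
  have *: "inner c (Y' x - P' e x) = 0" if c: "\<And>u. u \<in> ?R \<Longrightarrow> inner c u = 0" for c
  proof -
    \<comment> \<open>The complement of the range is contained in the kernel: the right-hand side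
      pairs \<open>c\<close> with an element of the range.\<close>
    have "inner (P s0 c) (P s0 c) = - inner c (P s0 (P s0 c))" using skew(2) unfolding skew_def by blast
    with c have Pc: "P s0 c = 0" by simp
    have 1: "((\<lambda>s. inner c (Y s - P s e)) has_derivative (\<lambda>v. inner c (Y' v - P' e v))) (at s0 within V)"
      using Y(1) der by (auto intro!: derivative_eq_intros)
    have 2: "((\<lambda>s. inner c (Y s - P s e)) has_derivative (\<lambda>v. 0)) (at s0 within V)"
    proof (rule has_derivative_zero_of_bound)
      show "((\<lambda>s. K * norm (P s c)) \<longlongrightarrow> 0) (at s0 within V)"
        using tendsto_mult_left[OF tendsto_norm[OF lim[of c]], of K] Pc by simp
      show "\<forall>\<^sub>F s in at s0 within V. norm (inner c (Y s - P s e)) \<le> K * norm (P s c) * norm (s - s0)"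
        using k(2) skew(1)
      proof eventually_elim
        case (elim s)
        have "norm (inner c (Y s - P s e)) = norm (inner (k s) (P s c))"
          using elim unfolding skew_def by (metis abs_minus_cancel real_norm_def)
        also have "\<dots> \<le> norm (k s) * norm (P s c)" using Cauchy_Schwarz_ineq2 by simp
        also have "\<dots> \<le> K * norm (s - s0) * norm (P s c)" using elim by (intro mult_right_mono) auto
        finally show ?case by (simp add: ac_simps)
      qed
    qed (use e in simp)
    show ?thesis by (rule has_derivative_within_subspace_unique[OF V x 1 2])
  qed
  obtain y z where yz: "y \<in> ?R" "\<And>u. u \<in> ?R \<Longrightarrow> orthogonal z u" "Y' x - P' e x = y + z"
    using orthogonal_subspace_decomp_exists[of ?R "Y' x - P' e x"] span_eq_iff[of ?R] R by metis
  have "inner z (y + z) = 0" using *[of z] yz by (simp add: orthogonal_def)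
  then have "z = 0" using yz by (simp add: orthogonal_def inner_right_distrib)
  with yz show ?thesis by simp
qed

text \<open>With the preimages \<open>e + k\<close> of \<open>Y\<close> and \<open>f + l\<close> of
  \<open>Z\<close>, skewness gives \<open>w = inner f Y - inner e Z + inner e (P f) + inner l (Y - P
  e)\<close>. The last term is a product of two first-order quantities, and the other three are
  differentiable by hypothesis.\<close>

lemma pairing_has_derivative:
  assumes Y: "(Y has_derivative Y') (at s0 within V)"
    "\<forall>\<^sub>F s in at s0 within V. Y s \<in> range (P s)" and e: "Y s0 = P s0 e"
    and Z: "(Z has_derivative Z') (at s0 within V)"
    "\<forall>\<^sub>F s in at s0 within V. Z s \<in> range (P s)" and f: "Z s0 = P s0 f"
    and w: "\<forall>\<^sub>F s in at s0 within V. \<forall>k l. P s k = Y s \<and> P s l = Z s \<longrightarrow> w s = inner l (P s k)"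
    and w0: "w s0 = inner f (P s0 e)"
  shows "(w has_derivative (\<lambda>x. inner f (Y' x) - inner e (Z' x) + inner e (P' f x))) (at s0 within V)"
proof -
  obtain k K where k: "K > 0" "\<forall>\<^sub>F s in at s0 within V. P s (k s) = Y s - P s e \<and>
     norm (k s) \<le> K * norm (s - s0) \<and> norm (Y s - P s e) \<le> K * norm (s - s0)"
    by (rule preimage_growth[OF Y e])
  obtain l L where l: "L > 0" "\<forall>\<^sub>F s in at s0 within V. P s (l s) = Z s - P s f \<and>
     norm (l s) \<le> L * norm (s - s0) \<and> norm (Z s - P s f) \<le> L * norm (s - s0)"
    by (rule preimage_growth[OF Z f])
  \<comment> \<open>The quadratic remainder \<open>inner (l s) (Y s - P s e)\<close>, written as a
    difference so that it is also defined where no preimages are at hand.\<close>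
  define r where "r s = w s - (inner f (Y s) - inner e (Z s) + inner e (P s f))" for s
  have "(r has_derivative (\<lambda>_. 0)) (at s0 within V)"
  proof (rule has_derivative_zero_of_bound)
    have "((\<lambda>s. L * (K * norm (s - s0))) \<longlongrightarrow> L * (K * norm (s0 - s0))) (at s0 within V)"
      by (intro tendsto_intros)
    then show "((\<lambda>s. L * (K * norm (s - s0))) \<longlongrightarrow> 0) (at s0 within V)" by simp
    show "\<forall>\<^sub>F s in at s0 within V. norm (r s) \<le> L * (K * norm (s - s0)) * norm (s - s0)"
      using k(2) l(2) w skew(1)
    proof eventually_elim
      case (elim s)
      have lin: "linear (P s)" using elim by (simp add: skew_def)
      have 1: "P s (e + k s) = Y s" "P s (f + l s) = Z s" using elim by (simp_all add: linear_add[OF lin])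
      then have "w s = inner (f + l s) (P s (e + k s))" using elim by blast
      then have "w s = inner (f + l s) (Y s)" by (simp only: 1)
      moreover have "inner (l s) (P s e) = - inner e (P s (l s))"
        using elim unfolding skew_def by blast
      ultimately have "r s = inner (l s) (Y s - P s e)"
        using elim by (simp add: r_def inner_diff_right inner_add_left)
      also have "norm \<dots> \<le> norm (l s) * norm (Y s - P s e)" using Cauchy_Schwarz_ineq2 by simp
      also have "\<dots> \<le> (L * norm (s - s0)) * (K * norm (s - s0))"
        using elim l k by (intro mult_mono) auto
      finally show ?case by (simp add: ac_simps)
    qed
    show "r s0 = 0" using w0 e f by (simp add: r_def)
  qed
  moreover have "((\<lambda>s. inner f (Y s) - inner e (Z s) + inner e (P s f)) has_derivative
      (\<lambda>x. inner f (Y' x) - inner e (Z' x) + inner e (P' f x))) (at s0 within V)"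
    using Y(1) Z(1) der by (auto intro!: derivative_eq_intros)
  ultimately show ?thesis
    using has_derivative_add[of r "\<lambda>_. 0" "at s0 within V"] by (fastforce simp: r_def)
qed

end

section \<open>Tangent vectors and smooth functions in charts\<close>

lemma charts_at_iff: "c \<in> charts_at M p \<longleftrightarrow> c \<in> atlas M \<and> p \<in> fst c"
  by (simp add: charts_at_def)

abbreviation transition_deriv ::
  "('a, 'e::euclidean_space) mfd \<Rightarrow> ('a, 'e) chart \<Rightarrow> ('a, 'e) chart \<Rightarrow> 'a \<Rightarrow> 'e \<Rightarrow> 'e" where
  "transition_deriv M c d p \<equiv>
     frechet_derivative (snd d \<circ> chart_inv c) (at (snd c p) within model M)"

section \<open>Charts and transition derivatives\<close>

locale smooth_mfd =
  fixes M :: "('a, 'e::euclidean_space) mfd"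
  assumes smooth_manifold: "smooth_manifold M"
begin

lemma subspace_model: "subspace (model M)"
  using smooth_manifold by (simp add: smooth_manifold_def)

lemma openin_chart: "c \<in> atlas M \<Longrightarrow> openin (mtop M) (fst c)"
  using smooth_manifold by (simp add: smooth_manifold_def)

lemma chart_subset_points: "c \<in> atlas M \<Longrightarrow> fst c \<subseteq> points M"
  using openin_chart openin_subset by blast

lemma points_chartE:
  assumes "p \<in> points M"
  obtains c where "c \<in> atlas M" "p \<in> fst c"
  using assms smooth_manifold by (auto simp: smooth_manifold_def)

lemma chart_at:
  assumes "p \<in> points M"
  shows "chart_at M p \<in> atlas M" "p \<in> fst (chart_at M p)"
proof -
  have "\<exists>c. c \<in> charts_at M p" using points_chartE[OF assms] unfolding charts_at_iff by metis
  from someI_ex[OF this] show "chart_at M p \<in> atlas M" "p \<in> fst (chart_at M p)"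
    by (auto simp: chart_at_def charts_at_iff)
qed

lemma chart_homeomorphic:
  "c \<in> atlas M \<Longrightarrow>
    homeomorphic_map (subtopology (mtop M) (fst c)) (top_of_set (snd c ` fst c)) (snd c)"
  using smooth_manifold by (simp add: smooth_manifold_def)

lemma inj_on_chart:
  assumes "c \<in> atlas M"
  shows "inj_on (snd c) (fst c)"
  using homeomorphic_imp_injective_map[OF chart_homeomorphic[OF assms]] chart_subset_points[OF assms]
  by (simp add: inf_absorb2)

lemma chart_inv_chart: "c \<in> atlas M \<Longrightarrow> p \<in> fst c \<Longrightarrow> chart_inv c (snd c p) = p"
  by (simp add: inj_on_chart)

lemma openin_chart_image:
  assumes "c \<in> atlas M" "openin (mtop M) U"
  shows "openin (top_of_set (model M)) (snd c ` (fst c \<inter> U))"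
proof -
  have "openin (subtopology (mtop M) (fst c)) (fst c \<inter> U)"
    using assms(2) by (metis inf_commute openin_subtopology_Int)
  then have "openin (top_of_set (snd c ` fst c)) (snd c ` (fst c \<inter> U))"
    using homeomorphic_imp_open_map[OF chart_homeomorphic[OF assms(1)]] by (simp add: open_map_def)
  moreover have "openin (top_of_set (model M)) (snd c ` fst c)"
    using smooth_manifold assms(1) by (simp add: smooth_manifold_def)
  ultimately show ?thesis using openin_trans by blast
qed

lemma chart_mem_model:
  assumes "c \<in> atlas M" "p \<in> fst c"
  shows "snd c p \<in> model M"
  using openin_imp_subset[OF openin_chart_image[OF assms(1) openin_chart[OF assms(1)]]] assms by blast

lemma eventually_chart_inv:
  assumes "c \<in> atlas M" "p \<in> fst c" "openin (mtop M) U" "p \<in> U"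
  shows "\<forall>\<^sub>F x in at (snd c p) within model M. chart_inv c x \<in> fst c \<inter> U \<and> snd c (chart_inv c x) = x"
  using eventually_in_openin_subspace[OF openin_chart_image[OF assms(1,3)], of "snd c p"] assms
  by (auto elim!: eventually_mono simp: chart_inv_chart)

lemma has_derivative_chart_cong:
  assumes "c \<in> atlas M" "p \<in> fst c" "openin (mtop M) U" "p \<in> U" "\<And>q. q \<in> U \<Longrightarrow> f q = g q"
    and "(f \<circ> chart_inv c has_derivative f') (at (snd c p) within model M)"
  shows "(g \<circ> chart_inv c has_derivative f') (at (snd c p) within model M)"
proof (rule has_derivative_transform_openin[OF openin_chart_image[OF assms(1,3)] _ _ assms(6)])
  show "(f \<circ> chart_inv c) y = (g \<circ> chart_inv c) y" if "y \<in> snd c ` (fst c \<inter> U)" for y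
    using that assms by (auto simp: chart_inv_chart)
qed (use assms in auto)

lemma transition_smooth:
  "c \<in> atlas M \<Longrightarrow> d \<in> atlas M \<Longrightarrow>
    smooth_on (model M) (snd c ` (fst c \<inter> fst d)) (snd d \<circ> chart_inv c)"
  using smooth_manifold by (simp add: smooth_manifold_def)

lemma transition_has_derivative:
  assumes "c \<in> atlas M" "p \<in> fst c" "d \<in> atlas M" "p \<in> fst d"
  shows "(snd d \<circ> chart_inv c has_derivative transition_deriv M c d p) (at (snd c p) within model M)"
  by (rule smooth_onD[OF transition_smooth]) (use assms in auto)

lemma has_derivative_change_chart:
  assumes c: "c \<in> atlas M" "p \<in> fst c" and d: "d \<in> atlas M" "p \<in> fst d"
    and f: "(f \<circ> chart_inv d has_derivative f') (at (snd d p) within model M)"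
  shows "(f \<circ> chart_inv c has_derivative (\<lambda>v. f' (transition_deriv M c d p v))) (at (snd c p) within model M)"
proof -
  let ?A = "snd c ` (fst c \<inter> fst d)"
  have A: "openin (top_of_set (model M)) ?A" "snd c p \<in> ?A"
    using openin_chart_image[OF c(1) openin_chart[OF d(1)]] c d by auto
  note f' = f[unfolded comp_def]
  have "((\<lambda>x. (f \<circ> chart_inv d) ((snd d \<circ> chart_inv c) x)) has_derivative
      (\<lambda>v. f' (transition_deriv M c d p v))) (at (snd c p) within model M)"
    by (rule has_derivative_compose_openin[OF A transition_has_derivative[OF c d], where W="model M"])
       (use c d f' in \<open>auto simp: chart_inv_chart chart_mem_model\<close>)
  then show ?thesis
    by (rule has_derivative_transform_openin[OF A, rotated]) (use c d in \<open>auto simp: chart_inv_chart\<close>)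
qed

lemma chart_derivative_unique:
  assumes "c \<in> atlas M" "p \<in> fst c" "v \<in> model M"
    and "(f has_derivative f') (at (snd c p) within model M)"
    and "(f has_derivative f'') (at (snd c p) within model M)"
  shows "f' v = f'' v"
  by (rule has_derivative_within_subspace_unique[OF subspace_model chart_mem_model]) (use assms in auto)

lemma transition_deriv_self:
  assumes c: "c \<in> atlas M" "p \<in> fst c" and v: "v \<in> model M"
  shows "transition_deriv M c c p v = v"
proof -
  have "(snd c \<circ> chart_inv c has_derivative (\<lambda>v. v)) (at (snd c p) within model M)"
    by (rule has_derivative_transform_openin[OF openin_chart_image[OF c(1) openin_chart[OF c(1)]] _ _ has_derivative_ident])
       (use c in \<open>auto simp: chart_inv_chart\<close>)
  from chart_derivative_unique[OF c v transition_has_derivative[OF c c] this] show ?thesis .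
qed

lemma transition_deriv_mem:
  assumes c: "c \<in> atlas M" "p \<in> fst c" and d: "d \<in> atlas M" "p \<in> fst d" and v: "v \<in> model M"
  shows "transition_deriv M c d p v \<in> model M"
proof (rule has_derivative_mem_subspace[OF subspace_model chart_mem_model[OF c] v subspace_model
      transition_has_derivative[OF c d]])
  show "\<forall>\<^sub>F y in at (snd c p) within model M. (snd d \<circ> chart_inv c) y \<in> model M"
    using eventually_chart_inv[OF c openin_chart[OF d(1)] d(2)]
    by eventually_elim (use d chart_mem_model in auto)
qed (use c d in \<open>simp add: chart_inv_chart chart_mem_model\<close>)

text \<open>The cocycle identity, from the chain rule and uniqueness of derivatives on the model
  space. It is what makes \<open>coord_vector\<close> a compatible family.\<close>

lemma transition_deriv_trans:
  assumes c: "c \<in> atlas M" "p \<in> fst c" and d: "d \<in> atlas M" "p \<in> fst d"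
    and e: "e \<in> atlas M" "p \<in> fst e" and v: "v \<in> model M"
  shows "transition_deriv M d e p (transition_deriv M c d p v) = transition_deriv M c e p v"
  by (rule chart_derivative_unique[OF c v has_derivative_change_chart[OF c d
          transition_has_derivative[OF d e]] transition_has_derivative[OF c e]])

lemma bounded_linear_transition_deriv:
  assumes "c \<in> atlas M" "p \<in> fst c" "d \<in> atlas M" "p \<in> fst d"
  shows "bounded_linear (transition_deriv M c d p)"
  by (rule has_derivative_bounded_linear[OF transition_has_derivative[OF assms]])

section \<open>Tangent vectors and their representatives\<close>

lemma coord_vector_apply:
  "d \<in> atlas M \<Longrightarrow> p \<in> fst d \<Longrightarrow> coord_vector M c a p d = transition_deriv M c d p a"
  by (simp add: coord_vector_def charts_at_iff)

lemma coord_vector_self: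
  "c \<in> atlas M \<Longrightarrow> p \<in> fst c \<Longrightarrow> a \<in> model M \<Longrightarrow> coord_vector M c a p c = a"
  by (simp add: coord_vector_apply transition_deriv_self)

lemma coord_vector_mem_tangent_space:
  assumes c: "c \<in> atlas M" "p \<in> fst c" and a: "a \<in> model M"
  shows "coord_vector M c a p \<in> tangent_space M p"
  unfolding tangent_space_def mem_Collect_eq
proof (intro ballI conjI ext)
  fix d assume "d \<in> charts_at M p"
  then have d: "d \<in> atlas M" "p \<in> fst d" by (auto simp: charts_at_iff)
  show "coord_vector M c a p d \<in> model M"
    using transition_deriv_mem[OF c d a] by (simp add: coord_vector_apply d)
  fix e
  show "coord_vector M c a p e = coord_vector M d (coord_vector M c a p d) p e"
    using transition_deriv_trans[OF c d _ _ a, of e]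
    by (simp add: coord_vector_apply[OF d]) (simp add: coord_vector_def charts_at_iff)
qed

lemma tangent_vector_mem_model:
  "v \<in> tangent_space M p \<Longrightarrow> c \<in> atlas M \<Longrightarrow> p \<in> fst c \<Longrightarrow> v c \<in> model M"
  by (auto simp: tangent_space_def charts_at_iff)

lemma tangent_vector_eq:
  "v \<in> tangent_space M p \<Longrightarrow> c \<in> atlas M \<Longrightarrow> p \<in> fst c \<Longrightarrow> coord_vector M c (v c) p = v"
  by (simp add: tangent_space_def charts_at_iff)

lemma tangent_vector_eqI:
  "v \<in> tangent_space M p \<Longrightarrow> w \<in> tangent_space M p \<Longrightarrow> c \<in> atlas M \<Longrightarrow> p \<in> fst c \<Longrightarrow> v c = w c \<Longrightarrow> v = w"
  using tangent_vector_eq by metis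

lemma coord_vector_add:
  assumes "c \<in> atlas M" "p \<in> fst c"
  shows "coord_vector M c (a + b) p = (\<lambda>d. coord_vector M c a p d + coord_vector M c b p d)"
  unfolding coord_vector_def charts_at_iff
  using bounded_linear_transition_deriv[OF assms, THEN bounded_linear.linear]
  by (intro ext) (simp add: linear_add linear_scale)

lemma coord_vector_scaleR:
  assumes "c \<in> atlas M" "p \<in> fst c"
  shows "coord_vector M c (r *\<^sub>R a) p = (\<lambda>d. r *\<^sub>R coord_vector M c a p d)"
  unfolding coord_vector_def charts_at_iff
  using bounded_linear_transition_deriv[OF assms, THEN bounded_linear.linear]
  by (intro ext) (simp add: linear_add linear_scale)

lemma coord_vector_zero:
  assumes "c \<in> atlas M" "p \<in> fst c"
  shows "coord_vector M c 0 p = (\<lambda>d. 0)"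
  using coord_vector_scaleR[OF assms, of 0 0] by simp

lemma coord_vector_sum:
  assumes "c \<in> atlas M" "p \<in> fst c"
  shows "coord_vector M c (\<Sum>i\<in>I. r i *\<^sub>R a i) p = (\<lambda>d. \<Sum>i\<in>I. r i *\<^sub>R coord_vector M c (a i) p d)"
  by (induction I rule: infinite_finite_induct)
     (simp_all add: coord_vector_zero[OF assms] coord_vector_add[OF assms] coord_vector_scaleR[OF assms])

lemma tangent_space_zero: "p \<in> points M \<Longrightarrow> (\<lambda>d. 0) \<in> tangent_space M p"
  using points_chartE[of p] coord_vector_zero coord_vector_mem_tangent_space[of _ p 0]
    subspace_0[OF subspace_model] by metis

lemma tangent_space_add:
  assumes "p \<in> points M" "v \<in> tangent_space M p" "w \<in> tangent_space M p"
  shows "(\<lambda>d. v d + w d) \<in> tangent_space M p"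
proof -
  obtain c where c: "c \<in> atlas M" "p \<in> fst c" using assms points_chartE by blast
  have "coord_vector M c (v c + w c) p \<in> tangent_space M p"
    using assms c by (intro coord_vector_mem_tangent_space subspace_add subspace_model tangent_vector_mem_model)
  then show ?thesis using assms c by (simp add: coord_vector_add tangent_vector_eq)
qed

lemma tangent_space_scaleR:
  assumes "p \<in> points M" "v \<in> tangent_space M p"
  shows "(\<lambda>d. r *\<^sub>R v d) \<in> tangent_space M p"
proof -
  obtain c where c: "c \<in> atlas M" "p \<in> fst c" using assms points_chartE by blast
  have "coord_vector M c (r *\<^sub>R v c) p \<in> tangent_space M p"
    using assms c by (intro coord_vector_mem_tangent_space subspace_scale subspace_model tangent_vector_mem_model)
  then show ?thesis using assms c by (simp add: coord_vector_scaleR tangent_vector_eq)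
qed

section \<open>Directional derivatives and smooth functions\<close>

text \<open>Removes the arbitrary chart \<open>chart_at M p\<close> from \<open>dirder\<close>: any
  chart at \<open>p\<close> and any derivative in it may be used, since the transition derivative
  carries one representative of \<open>v\<close> to the other.\<close>

lemma dirder_eq:
  assumes c: "c \<in> atlas M" "p \<in> fst c" and v: "v \<in> tangent_space M p"
    and f: "(f \<circ> chart_inv c has_derivative f') (at (snd c p) within model M)"
  shows "dirder M f p v = f' (v c)"
proof -
  define d where "d = chart_at M p"
  have d: "d \<in> atlas M" "p \<in> fst d"
    unfolding d_def using chart_at[of p] chart_subset_points[OF c(1)] c(2) by auto
  have "dirder M f p v = frechet_derivative (f \<circ> chart_inv d) (at (snd d p) within model M) (v d)"
    by (simp add: dirder_def d_def Let_def)
  also have "\<dots> = f' (transition_deriv M d c p (v d))"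
    by (rule frechet_derivative_within_subspace[OF subspace_model chart_mem_model[OF d]
          tangent_vector_mem_model[OF v d] has_derivative_change_chart[OF d c f]])
  also have "transition_deriv M d c p (v d) = v c"
    using tangent_vector_eq[OF v d] coord_vector_apply[OF c] by metis
  finally show ?thesis .
qed

lemma smooth_fun_has_derivative:
  assumes "smooth_fun M U f" "c \<in> atlas M" "p \<in> fst c" "p \<in> U"
  shows "(f \<circ> chart_inv c has_derivative
    frechet_derivative (f \<circ> chart_inv c) (at (snd c p) within model M)) (at (snd c p) within model M)"
  using assms unfolding smooth_fun_def by (intro smooth_onD[of _ "snd c ` (fst c \<inter> U)"]) auto

lemma smooth_fun_subset: "smooth_fun M U f \<Longrightarrow> U' \<subseteq> U \<Longrightarrow> smooth_fun M U' f"
  unfolding smooth_fun_def by (meson smooth_on_subset image_mono Int_mono subset_refl)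

lemma smooth_fun_cong:
  assumes U: "openin (mtop M) U" and f: "smooth_fun M U f" "\<And>q. q \<in> U \<Longrightarrow> f q = g q"
  shows "smooth_fun M U g"
  unfolding smooth_fun_def smooth_on_def
proof (intro ballI allI)
  fix c k assume c: "c \<in> atlas M"
  with f(1) have "Ck_on k (model M) (snd c ` (fst c \<inter> U)) (f \<circ> chart_inv c)"
    by (simp add: smooth_fun_def smooth_on_def)
  then show "Ck_on k (model M) (snd c ` (fst c \<inter> U)) (g \<circ> chart_inv c)"
    by (rule Ck_on_cong[OF subspace_model openin_chart_image[OF c U]])
       (use c f in \<open>auto simp: chart_inv_chart\<close>)
qed

lemma smooth_fun_const: "openin (mtop M) U \<Longrightarrow> smooth_fun M U (\<lambda>q. w)"
  unfolding smooth_fun_def smooth_on_def comp_def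
  by (intro ballI allI Ck_on_const[OF subspace_model openin_chart_image])

lemma smooth_fun_add:
  "openin (mtop M) U \<Longrightarrow> smooth_fun M U f \<Longrightarrow> smooth_fun M U g \<Longrightarrow> smooth_fun M U (\<lambda>q. f q + g q)"
  unfolding smooth_fun_def smooth_on_def comp_def
  by (intro ballI allI Ck_on_add[OF subspace_model openin_chart_image]) auto

lemma smooth_fun_scaleR:
  fixes f :: "'a \<Rightarrow> real"
  shows "openin (mtop M) U \<Longrightarrow> smooth_fun M U f \<Longrightarrow> smooth_fun M U g
    \<Longrightarrow> smooth_fun M U (\<lambda>q. f q *\<^sub>R g q)"
  unfolding smooth_fun_def smooth_on_def comp_def
  by (intro ballI allI Ck_on_scaleR[OF subspace_model openin_chart_image]) auto

lemma smooth_fun_linear: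
  assumes "openin (mtop M) U" "smooth_fun M U f" "bounded_linear L"
  shows "smooth_fun M U (\<lambda>q. L (f q))"
  using assms(2) unfolding smooth_fun_def smooth_on_def comp_def
  by (auto intro!: Ck_on_linear[OF subspace_model openin_chart_image[OF _ assms(1)] assms(3)])

lemma smooth_fun_sum:
  assumes "openin (mtop M) U" "finite I" "\<And>i. i \<in> I \<Longrightarrow> smooth_fun M U (f i)"
  shows "smooth_fun M U (\<lambda>q. \<Sum>i\<in>I. f i q)"
  using assms(2,3) by (induction I rule: finite_induct) (auto intro: smooth_fun_const smooth_fun_add assms(1))

lemma dirder_const: "p \<in> points M \<Longrightarrow> v \<in> tangent_space M p \<Longrightarrow> dirder M (\<lambda>q. w) p v = 0"
  using dirder_eq[OF chart_at, of p v "\<lambda>q. w" "\<lambda>_. 0"] by (simp add: comp_def)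

lemma dirder_cong:
  assumes U: "openin (mtop M) U" "p \<in> U" and v: "v \<in> tangent_space M p"
    and f: "smooth_fun M U f" "\<And>q. q \<in> U \<Longrightarrow> f q = g q"
  shows "dirder M f p v = dirder M g p v"
proof -
  have "p \<in> points M" using U openin_subset by blast
  note c = chart_at[OF this]
  note f' = smooth_fun_has_derivative[OF f(1) c U(2)]
  show ?thesis
    using dirder_eq[OF c v f'] dirder_eq[OF c v has_derivative_chart_cong[OF c U f(2) f']] by simp
qed

lemma dirder_add:
  assumes U: "openin (mtop M) U" "p \<in> U" and v: "v \<in> tangent_space M p"
    and f: "smooth_fun M U f" "smooth_fun M U g"
  shows "dirder M (\<lambda>q. f q + g q) p v = dirder M f p v + dirder M g p v"
proof -
  have "p \<in> points M" using U openin_subset by blast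
  note c = chart_at[OF this]
  note f' = smooth_fun_has_derivative[OF f(1) c U(2)] and g' = smooth_fun_has_derivative[OF f(2) c U(2)]
  show ?thesis
    using dirder_eq[OF c v f'] dirder_eq[OF c v g'] dirder_eq[OF c v, of "\<lambda>q. f q + g q"]
      has_derivative_add[OF f' g']
    by (simp add: comp_def)
qed

lemma dirder_sum:
  assumes U: "openin (mtop M) U" "p \<in> U" and v: "v \<in> tangent_space M p"
    and f: "finite I" "\<And>i. i \<in> I \<Longrightarrow> smooth_fun M U (f i)"
  shows "dirder M (\<lambda>q. \<Sum>i\<in>I. f i q) p v = (\<Sum>i\<in>I. dirder M (f i) p v)"
  using f
proof (induction I rule: finite_induct)
  case empty
  have "p \<in> points M" using U openin_subset by blast
  then show ?case by (simp add: dirder_const[OF _ v])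
next
  case (insert i I)
  then show ?case by (simp add: dirder_add[OF U v _ smooth_fun_sum[OF U(1)]])
qed

lemma dirder_linear:
  assumes U: "openin (mtop M) U" "p \<in> U" and v: "v \<in> tangent_space M p"
    and f: "smooth_fun M U f" and L: "bounded_linear L"
  shows "dirder M (\<lambda>q. L (f q)) p v = L (dirder M f p v)"
proof -
  have "p \<in> points M" using U openin_subset by blast
  note c = chart_at[OF this]
  note f' = smooth_fun_has_derivative[OF f(1) c U(2)]
  show ?thesis
    using dirder_eq[OF c v f'] dirder_eq[OF c v, of "\<lambda>q. L (f q)"] bounded_linear.has_derivative[OF L f']
    by (simp add: comp_def)
qed

section \<open>Vector fields in charts\<close>

lemma vector_fields_mem: "X \<in> vector_fields M U \<Longrightarrow> p \<in> U \<Longrightarrow> X p \<in> tangent_space M p"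
  by (simp add: vector_fields_def)

lemma vector_fields_smooth:
  "X \<in> vector_fields M U \<Longrightarrow> c \<in> atlas M \<Longrightarrow> smooth_fun M (U \<inter> fst c) (\<lambda>q. X q c)"
  by (simp add: vector_fields_def)

lemma vector_fields_subset: "X \<in> vector_fields M U \<Longrightarrow> U' \<subseteq> U \<Longrightarrow> X \<in> vector_fields M U'"
  by (auto simp: vector_fields_def intro: smooth_fun_subset)

lemma vector_fields_add:
  assumes "openin (mtop M) U" "X \<in> vector_fields M U" "Y \<in> vector_fields M U"
  shows "(\<lambda>q d. X q d + Y q d) \<in> vector_fields M U"
  using assms openin_subset[OF assms(1)] unfolding vector_fields_def
  by (auto intro!: tangent_space_add smooth_fun_add openin_Int openin_chart)

lemma vector_fields_scaleR:
  assumes "openin (mtop M) U" "smooth_fun M U f" "X \<in> vector_fields M U"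
  shows "(\<lambda>q d. f q *\<^sub>R X q d) \<in> vector_fields M U"
  using assms openin_subset[OF assms(1)] unfolding vector_fields_def
  by (auto intro!: tangent_space_scaleR smooth_fun_scaleR openin_Int openin_chart
      intro: smooth_fun_subset)

lemma vector_fields_zero: "openin (mtop M) U \<Longrightarrow> (\<lambda>q d. 0) \<in> vector_fields M U"
  using openin_subset unfolding vector_fields_def
  by (auto intro!: tangent_space_zero smooth_fun_const openin_Int openin_chart)

lemma vector_fields_sum:
  assumes "openin (mtop M) U" "finite I" "\<And>i. i \<in> I \<Longrightarrow> smooth_fun M U (f i)"
    "\<And>i. i \<in> I \<Longrightarrow> X i \<in> vector_fields M U"
  shows "(\<lambda>q d. \<Sum>i\<in>I. f i q *\<^sub>R X i q d) \<in> vector_fields M U"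
  using assms(2-4)
  by (induction I rule: finite_induct)
     (auto intro!: vector_fields_zero vector_fields_add[where X="\<lambda>q d. f _ q *\<^sub>R X _ q d"]
       vector_fields_scaleR assms(1))

text \<open>Read in a third chart \<open>e\<close>, the component in \<open>d\<close> is the
  derivative of the transition from \<open>c\<close> to \<open>d\<close> in the fixed direction
  \<open>a\<close>, composed with the transition from \<open>e\<close> to \<open>c\<close>; both are
  smooth.\<close>

lemma coord_vector_field:
  assumes c: "c \<in> atlas M" and a: "a \<in> model M"
  shows "coord_vector M c a \<in> vector_fields M (fst c)"
  unfolding vector_fields_def mem_Collect_eq smooth_fun_def smooth_on_def
proof (intro conjI ballI allI coord_vector_mem_tangent_space[OF c _ a])
  fix d e k assume d: "d \<in> atlas M" and e: "e \<in> atlas M"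
  let ?V = "model M" and ?A = "snd e ` (fst e \<inter> (fst c \<inter> fst d))"
  have A: "openin (top_of_set ?V) ?A"
    using c d by (intro openin_chart_image e openin_Int openin_chart)
  show "Ck_on k ?V ?A ((\<lambda>p. coord_vector M c a p d) \<circ> chart_inv e)"
  proof (rule Ck_on_cong[OF subspace_model A])
    show "Ck_on k ?V ?A (\<lambda>x. frechet_derivative (snd d \<circ> chart_inv c)
        (at ((snd c \<circ> chart_inv e) x) within ?V) a)"
    proof (rule Ck_on_compose[OF subspace_model A subspace_model openin_chart_image[OF c openin_chart[OF d]],
          where f = "snd c \<circ> chart_inv e"])
      show "Ck_on k ?V ?A (snd c \<circ> chart_inv e)"
        using smooth_on_subset[OF transition_smooth[OF e c], of ?A] unfolding smooth_on_def by blast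
      show "Ck_on k ?V (snd c ` (fst c \<inter> fst d))
          (\<lambda>y. frechet_derivative (snd d \<circ> chart_inv c) (at y within ?V) a)"
        using smooth_on_frechet_derivative[OF transition_smooth[OF c d] a] by (simp add: smooth_on_def)
    qed (use e in \<open>auto simp: chart_inv_chart\<close>)
  qed (use d e in \<open>auto simp: chart_inv_chart coord_vector_apply\<close>)
qed

lemma coord_expansion:
  assumes c: "c \<in> atlas M" "p \<in> fst c" and v: "v \<in> tangent_space M p"
  shows "v = (\<lambda>d. \<Sum>b\<in>onb (model M). inner b (v c) *\<^sub>R coord_vector M c b p d)"
  using tangent_vector_eq[OF v c] coord_vector_sum[OF c, of "\<lambda>b. inner b (v c)" "\<lambda>b. b" "onb (model M)"]
    onb_expansion[OF subspace_model tangent_vector_mem_model[OF v c]] by simp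

lemma smooth_component:
  assumes "openin (mtop M) U" "X \<in> vector_fields M U" "c \<in> atlas M" "U \<subseteq> fst c"
  shows "smooth_fun M U (\<lambda>q. inner b (X q c))"
  by (rule smooth_fun_linear[OF assms(1) _ bounded_linear_inner_right])
     (use vector_fields_smooth[OF assms(2,3)] assms(4) in \<open>simp add: inf_absorb1\<close>)

end

section \<open>Affine connections in coordinates\<close>

text \<open>The term \<open>\<Gamma>\<close> inside \<open>connection_along\<close>, with the chart
  as a parameter.\<close>

definition christoffel ::
  "('a, 'e::euclidean_space) mfd \<Rightarrow> ('a, 'e) conn \<Rightarrow> ('a, 'e) chart \<Rightarrow> 'a \<Rightarrow> 'e \<Rightarrow> 'e \<Rightarrow> 'e" where
  "christoffel M D c p a b = D (coord_vector M c a) (coord_vector M c b) p c"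

locale affine_mfd = smooth_mfd M for M :: "('a, 'e::euclidean_space) mfd" +
  fixes D :: "('a, 'e) conn"
  assumes affine: "affine_connection M D"
begin

lemma connection_mem:
  assumes "openin (mtop M) U" "X \<in> vector_fields M U" "Y \<in> vector_fields M U"
  shows "D X Y \<in> vector_fields M U"
  using spec[OF affine[unfolded affine_connection_def], THEN mp, OF assms(1), THEN conjunct1] assms(2,3)
  by (elim ballE) auto

lemma connection_cong:
  assumes "openin (mtop M) U" "p \<in> U" "X \<in> vector_fields M U" "X' \<in> vector_fields M U"
    "Y \<in> vector_fields M U" "Y' \<in> vector_fields M U"
    and "\<And>q. q \<in> U \<Longrightarrow> X q = X' q" "\<And>q. q \<in> U \<Longrightarrow> Y q = Y' q"
  shows "D X Y p = D X' Y' p"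
  by (rule spec[OF affine[unfolded affine_connection_def], THEN mp, OF assms(1), THEN conjunct2,
        THEN conjunct1, rule_format, OF assms(3-6) _ assms(2)]) (use assms(7,8) in auto)

lemma connection_add_left:
  assumes "openin (mtop M) U" "p \<in> U" "X \<in> vector_fields M U" "X' \<in> vector_fields M U" "Y \<in> vector_fields M U"
  shows "D (\<lambda>q d. X q d + X' q d) Y p = (\<lambda>d. D X Y p d + D X' Y p d)"
  by (rule spec[OF affine[unfolded affine_connection_def], THEN mp, OF assms(1),
        THEN conjunct2, THEN conjunct2, THEN conjunct1, rule_format, OF assms(3) assms(4) assms(5) assms(2)])

lemma connection_scale_left:
  assumes "openin (mtop M) U" "p \<in> U" "smooth_fun M U f" "X \<in> vector_fields M U" "Y \<in> vector_fields M U"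
  shows "D (\<lambda>q d. f q *\<^sub>R X q d) Y p = (\<lambda>d. f p *\<^sub>R D X Y p d)"
  by (rule spec[OF affine[unfolded affine_connection_def], THEN mp, OF assms(1),
        THEN conjunct2, THEN conjunct2, THEN conjunct2, THEN conjunct1, rule_format, OF assms(4) assms(5) assms(3) assms(2)])

lemma connection_add_right:
  assumes "openin (mtop M) U" "p \<in> U" "X \<in> vector_fields M U" "Y \<in> vector_fields M U" "Y' \<in> vector_fields M U"
  shows "D X (\<lambda>q d. Y q d + Y' q d) p = (\<lambda>d. D X Y p d + D X Y' p d)"
  by (rule spec[OF affine[unfolded affine_connection_def], THEN mp, OF assms(1),
        THEN conjunct2, THEN conjunct2, THEN conjunct2, THEN conjunct2, THEN conjunct1, rule_format, OF assms(3) assms(4) assms(5) assms(2)])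

lemma connection_scale_right:
  assumes "openin (mtop M) U" "p \<in> U" "smooth_fun M U f" "X \<in> vector_fields M U" "Y \<in> vector_fields M U"
  shows "D X (\<lambda>q d. f q *\<^sub>R Y q d) p = (\<lambda>d. dirder M f p (X p) *\<^sub>R Y p d + f p *\<^sub>R D X Y p d)"
  by (rule spec[OF affine[unfolded affine_connection_def], THEN mp, OF assms(1),
        THEN conjunct2, THEN conjunct2, THEN conjunct2, THEN conjunct2, THEN conjunct2, rule_format, OF assms(4) assms(5) assms(3) assms(2)])

lemma connection_zero_left:
  assumes "openin (mtop M) U" "p \<in> U" "Y \<in> vector_fields M U"
  shows "D (\<lambda>q d. 0) Y p = (\<lambda>d. 0)"
  using connection_scale_left[OF assms(1,2) smooth_fun_const[OF assms(1), of 0] assms(3,3)]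
    connection_cong[OF assms(1,2) vector_fields_zero[OF assms(1)] _ assms(3,3), of "\<lambda>q d. 0 *\<^sub>R Y q d"]
  by simp

lemma connection_zero_right:
  assumes U: "openin (mtop M) U" "p \<in> U" and X: "X \<in> vector_fields M U"
  shows "D X (\<lambda>q d. 0) p = (\<lambda>d. 0)"
proof -
  have "p \<in> points M" using U openin_subset by blast
  then show ?thesis
    using connection_scale_right[OF U smooth_fun_const[OF U(1), of 0] X X]
      dirder_const[OF _ vector_fields_mem[OF X U(2)], of "0::real"] by simp
qed

lemma connection_sum_left:
  assumes U: "openin (mtop M) U" "p \<in> U" and Y: "Y \<in> vector_fields M U"
    and X: "finite I" "\<And>i. i \<in> I \<Longrightarrow> smooth_fun M U (f i)" "\<And>i. i \<in> I \<Longrightarrow> X i \<in> vector_fields M U"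
  shows "D (\<lambda>q d. \<Sum>i\<in>I. f i q *\<^sub>R X i q d) Y p = (\<lambda>d. \<Sum>i\<in>I. f i p *\<^sub>R D (X i) Y p d)"
  using X
proof (induction I rule: finite_induct)
  case empty
  then show ?case by (simp add: connection_zero_left[OF U Y])
next
  case (insert i I)
  then show ?case
    using connection_add_left[OF U vector_fields_scaleR[OF U(1), of "f i" "X i"]
        vector_fields_sum[OF U(1), of I f X] Y]
      connection_scale_left[OF U, of "f i" "X i" Y] Y
    by simp
qed

lemma connection_sum_right:
  assumes U: "openin (mtop M) U" "p \<in> U" and X: "X \<in> vector_fields M U"
    and Y: "finite I" "\<And>i. i \<in> I \<Longrightarrow> smooth_fun M U (f i)" "\<And>i. i \<in> I \<Longrightarrow> Y i \<in> vector_fields M U"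
  shows "D X (\<lambda>q d. \<Sum>i\<in>I. f i q *\<^sub>R Y i q d) p
    = (\<lambda>d. \<Sum>i\<in>I. dirder M (f i) p (X p) *\<^sub>R Y i p d + f i p *\<^sub>R D X (Y i) p d)"
  using Y
proof (induction I rule: finite_induct)
  case empty
  then show ?case by (simp add: connection_zero_right[OF U X])
next
  case (insert i I)
  then show ?case
    using connection_add_right[OF U X vector_fields_scaleR[OF U(1), of "f i" "Y i"]
        vector_fields_sum[OF U(1), of I f Y]]
      connection_scale_right[OF U, of "f i" X "Y i"] X
    by simp
qed

text \<open>Both fields are expanded in coordinate fields and the connection axioms are applied
  termwise. The derivative terms of the Leibniz rule reassemble to the derivative of the component
  of \<open>Y\<close>; the Christoffel part stays a double sum until bilinearity is known.\<close>

lemma connection_coord_sum: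
  assumes U: "openin (mtop M) U" "p \<in> U" and c: "c \<in> atlas M" "U \<subseteq> fst c"
    and X: "X \<in> vector_fields M U" and Y: "Y \<in> vector_fields M U"
  defines "B \<equiv> onb (model M)"
  shows "D X Y p c = dirder M (\<lambda>q. Y q c) p (X p) +
    (\<Sum>b\<in>B. inner b (Y p c) *\<^sub>R (\<Sum>a\<in>B. inner a (X p c) *\<^sub>R christoffel M D c p a b))"
proof -
  have B: "finite B" "B \<subseteq> model M"
    unfolding B_def using subspace_model by (auto intro: finite_onb onb_subset[THEN subsetD])
  have pc: "p \<in> fst c" using U c by blast
  have E: "coord_vector M c b \<in> vector_fields M U" if "b \<in> B" for b
    using that B by (intro vector_fields_subset[OF coord_vector_field[OF c(1)] c(2)]) auto
  let ?X = "\<lambda>q d. \<Sum>b\<in>B. inner b (X q c) *\<^sub>R coord_vector M c b q d"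
  let ?Y = "\<lambda>q d. \<Sum>b\<in>B. inner b (Y q c) *\<^sub>R coord_vector M c b q d"
  note sm = smooth_component[OF U(1) _ c]
  have X': "?X \<in> vector_fields M U" and Y': "?Y \<in> vector_fields M U"
    by (auto intro!: vector_fields_sum[OF U(1) B(1)] sm X Y E)
  have eq: "X q = ?X q" "Y q = ?Y q" if "q \<in> U" for q
    unfolding B_def using that c
    by (auto intro!: coord_expansion[OF c(1)] vector_fields_mem[OF X] vector_fields_mem[OF Y])
  have D1: "D X Y p = D ?X ?Y p"
    by (rule connection_cong[OF U X X' Y Y' eq])
  have D2: "D ?X ?Y p c = (\<Sum>b\<in>B. dirder M (\<lambda>q. inner b (Y q c)) p (X p) *\<^sub>R coord_vector M c b p c
      + inner b (Y p c) *\<^sub>R D ?X (coord_vector M c b) p c)"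
    using connection_sum_right[OF U X' B(1) sm[OF Y] E] eq(1)[OF U(2)] by simp
  have D3: "D ?X (coord_vector M c b) p c = (\<Sum>a\<in>B. inner a (X p c) *\<^sub>R christoffel M D c p a b)"
    if b: "b \<in> B" for b
    using connection_sum_left[OF U E[OF b] B(1) sm[OF X] E] by (simp add: christoffel_def)
  note Xp = vector_fields_mem[OF X U(2)]
  have sY: "smooth_fun M U (\<lambda>q. Y q c)"
    using vector_fields_smooth[OF Y c(1)] c(2) by (simp add: inf_absorb1)
  have "dirder M (\<lambda>q. Y q c) p (X p) = dirder M (\<lambda>q. \<Sum>b\<in>B. inner b (Y q c) *\<^sub>R b) p (X p)"
    by (rule dirder_cong[OF U Xp sY])
       (use c in \<open>auto simp: B_def intro!: onb_expansion[symmetric, OF subspace_model]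
          tangent_vector_mem_model[OF vector_fields_mem[OF Y]]\<close>)
  also have "\<dots> = (\<Sum>b\<in>B. dirder M (\<lambda>q. inner b (Y q c) *\<^sub>R b) p (X p))"
    by (rule dirder_sum[OF U Xp B(1) smooth_fun_linear[OF U(1) sm[OF Y] bounded_linear_scaleR_left]])
  also have "\<dots> = (\<Sum>b\<in>B. dirder M (\<lambda>q. inner b (Y q c)) p (X p) *\<^sub>R b)"
    by (rule sum.cong[OF refl dirder_linear[OF U Xp sm[OF Y] bounded_linear_scaleR_left]])
  finally have "dirder M (\<lambda>q. Y q c) p (X p) =
    (\<Sum>b\<in>B. dirder M (\<lambda>q. inner b (Y q c)) p (X p) *\<^sub>R b)" .
  moreover have "coord_vector M c b p c = b" if "b \<in> B" for b
    using that B coord_vector_self[OF c(1) pc] by blast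
  ultimately show ?thesis by (simp add: D1 D2 D3 sum.distrib)
qed

section \<open>Bilinearity of the Christoffel term\<close>

text \<open>The coordinate formula applied to coordinate fields themselves: the component of the
  second field in \<open>c\<close> is constant, so the derivative term drops out.\<close>

lemma christoffel_expansion:
  assumes c: "c \<in> atlas M" "p \<in> fst c" and xy: "x \<in> model M" "y \<in> model M"
  defines "B \<equiv> onb (model M)"
  shows "christoffel M D c p x y =
    (\<Sum>b\<in>B. inner b y *\<^sub>R (\<Sum>a\<in>B. inner a x *\<^sub>R christoffel M D c p a b))"
proof -
  note op = openin_chart[OF c(1)]
  note E = coord_vector_field[OF c(1)]
  note Ep = coord_vector_mem_tangent_space[OF c xy(1)]
  have "dirder M (\<lambda>q. coord_vector M c y q c) p (coord_vector M c x p) = 0"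
    using dirder_cong[OF op c(2) Ep smooth_fun_const[OF op, of y], of "\<lambda>q. coord_vector M c y q c"]
      dirder_const[OF _ Ep, of y] chart_subset_points[OF c(1)] c(2) coord_vector_self[OF c(1) _ xy(2)]
    by (auto simp del: split_paired_All)
  then show ?thesis
    using connection_coord_sum[OF op c(2) c(1) subset_refl E[OF xy(1)] E[OF xy(2)]]
    by (simp add: christoffel_def B_def coord_vector_self[OF c] xy)
qed

lemma christoffel_linear_right:
  assumes c: "c \<in> atlas M" "p \<in> fst c" and xy: "x \<in> model M" "y \<in> model M"
  shows "christoffel M D c p x y = (\<Sum>b\<in>onb (model M). inner b y *\<^sub>R christoffel M D c p x b)"
proof -
  let ?B = "onb (model M)"
  \<comment> \<open>\<open>christoffel\<close> is controlled for arguments in the model space only;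
    \<open>F\<close> extends it linearly in the second argument to all of \<open>'e\<close>.\<close>
  define F where "F y = (\<Sum>b\<in>?B. inner b y *\<^sub>R (\<Sum>a\<in>?B. inner a x *\<^sub>R christoffel M D c p a b))" for y
  have F: "christoffel M D c p x y = F y" if "y \<in> model M" for y
    unfolding F_def by (rule christoffel_expansion[OF c xy(1) that])
  have "linear (\<lambda>y. \<Sum>b\<in>?B. inner b y *\<^sub>R S b)" for S :: "'e \<Rightarrow> 'e"
    by (rule linearI) (simp_all add: inner_add_right scaleR_add_left sum.distrib scaleR_sum_right)
  then have lin: "linear F" unfolding F_def .
  have "F y = F (\<Sum>b\<in>?B. inner b y *\<^sub>R b)" by (simp add: onb_expansion[OF subspace_model xy(2)])
  also have "\<dots> = (\<Sum>b\<in>?B. inner b y *\<^sub>R F b)" by (simp add: linear_sum[OF lin] linear_scale[OF lin])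
  also have "\<dots> = (\<Sum>b\<in>?B. inner b y *\<^sub>R christoffel M D c p x b)"
    using onb_subset[OF subspace_model] by (intro sum.cong) (auto simp: F)
  finally show ?thesis by (simp add: F xy)
qed

text \<open>\<open>D\<close> has no domain argument, so passing to the part of \<open>U\<close>
  inside the chart costs nothing and the expansion applies there.\<close>

lemma connection_coord:
  assumes U: "openin (mtop M) U" "p \<in> U" and c: "c \<in> atlas M" "p \<in> fst c"
    and X: "X \<in> vector_fields M U" and Y: "Y \<in> vector_fields M U"
  shows "D X Y p c = dirder M (\<lambda>q. Y q c) p (X p) + christoffel M D c p (X p c) (Y p c)"
proof -
  have W: "openin (mtop M) (U \<inter> fst c)" "p \<in> U \<inter> fst c" using U c openin_chart[OF c(1)] by auto
  have XY: "X \<in> vector_fields M (U \<inter> fst c)" "Y \<in> vector_fields M (U \<inter> fst c)"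
    using X Y vector_fields_subset by blast+
  show ?thesis
    using connection_coord_sum[OF W c(1) _ XY] U
      christoffel_expansion[OF c tangent_vector_mem_model[OF _ c] tangent_vector_mem_model[OF _ c]]
      vector_fields_mem[OF X] vector_fields_mem[OF Y]
    by simp
qed

end

section \<open>Covectors in coordinates\<close>

text \<open>The guard follows the convention that covectors vanish off the tangent space. The vector
  \<open>a\<close> ranges over all of \<open>'e\<close>, but only its orthogonal projection to the
  model space has an effect.\<close>

definition coord_covector ::
  "('a, 'e::euclidean_space) mfd \<Rightarrow> ('a, 'e) chart \<Rightarrow> 'e \<Rightarrow> 'a \<Rightarrow> ('a, 'e) covec" where
  "coord_covector M c a p v = (if v \<in> tangent_space M p then inner a (v c) else 0)"

text \<open>Membership and value are proved together because the induction step uses membership of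
  the partial sum. It serves both covectors on tangent vectors and \<open>\<pi>\<close> on
  covectors.\<close>

lemma linear_form_sum:
  assumes "linear_form T \<theta>" "(\<lambda>_. 0) \<in> T" "\<And>v w. v \<in> T \<Longrightarrow> w \<in> T \<Longrightarrow> (\<lambda>x. v x + w x) \<in> T"
    "\<And>r v. v \<in> T \<Longrightarrow> (\<lambda>x. r *\<^sub>R v x) \<in> T" "finite I" "\<And>i. i \<in> I \<Longrightarrow> v i \<in> T"
  shows "(\<lambda>x. \<Sum>i\<in>I. r i *\<^sub>R v i x) \<in> T \<and> \<theta> (\<lambda>x. \<Sum>i\<in>I. r i *\<^sub>R v i x) = (\<Sum>i\<in>I. r i * \<theta> (v i))"
proof -
  have add: "\<theta> (\<lambda>x. v x + w x) = \<theta> v + \<theta> w" if "v \<in> T" "w \<in> T" for v w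
    using assms(1) that unfolding linear_form_def by simp
  have scale: "\<theta> (\<lambda>x. r *\<^sub>R v x) = r * \<theta> v" if "v \<in> T" for r v
    using assms(1) that unfolding linear_form_def by simp
  show ?thesis using assms(5,6)
  proof (induction I rule: finite_induct)
    case empty
    show ?case using scale[OF assms(2), of 0] assms(2) by simp
  next
    case (insert i I)
    then have I: "(\<lambda>x. \<Sum>i\<in>I. r i *\<^sub>R v i x) \<in> T"
        "\<theta> (\<lambda>x. \<Sum>i\<in>I. r i *\<^sub>R v i x) = (\<Sum>i\<in>I. r i * \<theta> (v i))"
      and i: "v i \<in> T" by auto
    note ri = assms(4)[OF i, of "r i"]
    show ?case
      using assms(3)[OF ri I(1)] add[OF ri I(1)] scale[OF i] I(2) insert.hyps by simp
  qed
qed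

context smooth_mfd
begin

lemma coord_covector_mem:
  assumes "c \<in> atlas M" "p \<in> fst c"
  shows "coord_covector M c a p \<in> cotangent_space M p"
  using tangent_space_add tangent_space_scaleR chart_subset_points[OF assms(1)] assms
  by (auto simp: cotangent_space_def linear_form_def coord_covector_def inner_add_right)

lemma coord_covector_add:
  "coord_covector M c (a + b) p = (\<lambda>v. coord_covector M c a p v + coord_covector M c b p v)"
  by (auto simp: coord_covector_def inner_add_left)

lemma coord_covector_scaleR:
  "coord_covector M c (r *\<^sub>R a) p = (\<lambda>v. r *\<^sub>R coord_covector M c a p v)"
  by (auto simp: coord_covector_def)

lemma coord_covector_zero: "coord_covector M c 0 p = (\<lambda>v. 0)"
  by (auto simp: coord_covector_def)

text \<open>The witness is the Riesz vector of the form: its coefficient at \<open>b\<close> is the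
  value on the coordinate vector of \<open>b\<close>.\<close>

lemma cotangent_space_coord:
  assumes c: "c \<in> atlas M" "p \<in> fst c" and \<theta>: "\<theta> \<in> cotangent_space M p"
  obtains a where "\<theta> = coord_covector M c a p"
proof
  let ?B = "onb (model M)"
  have p: "p \<in> points M" using chart_subset_points c by blast
  have lin: "linear_form (tangent_space M p) \<theta>" and off: "\<And>v. v \<notin> tangent_space M p \<Longrightarrow> \<theta> v = 0"
    using \<theta> by (auto simp: cotangent_space_def)
  show "\<theta> = coord_covector M c (\<Sum>b\<in>?B. \<theta> (coord_vector M c b p) *\<^sub>R b) p"
  proof
    fix v
    show "\<theta> v = coord_covector M c (\<Sum>b\<in>?B. \<theta> (coord_vector M c b p) *\<^sub>R b) p v"
    proof (cases "v \<in> tangent_space M p")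
      case True
      have "\<theta> v = (\<Sum>b\<in>?B. inner b (v c) * \<theta> (coord_vector M c b p))"
        by (subst coord_expansion[OF c True], rule linear_form_sum[OF lin, THEN conjunct2])
           (use p c onb_subset[OF subspace_model] in \<open>auto intro!: tangent_space_zero
             tangent_space_add tangent_space_scaleR finite_onb subspace_model
             coord_vector_mem_tangent_space\<close>)
      then show ?thesis using True by (simp add: coord_covector_def inner_sum_left mult.commute)
    qed (simp add: coord_covector_def off)
  qed
qed

lemma coord_covector_one_form:
  assumes c: "c \<in> atlas M"
  shows "coord_covector M c a \<in> one_forms M (fst c)"
  unfolding one_forms_def mem_Collect_eq
proof (intro conjI ballI allI impI)
  fix W X assume W: "openin (mtop M) W \<and> W \<subseteq> fst c \<and> X \<in> vector_fields M W"
  show "smooth_fun M W (\<lambda>p. coord_covector M c a p (X p))"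
    by (rule smooth_fun_cong[OF _ smooth_component[OF _ _ c]])
       (use W vector_fields_mem in \<open>auto simp: coord_covector_def\<close>)
qed (rule coord_covector_mem[OF c])

lemma coord_covector_coord_vector:
  assumes "c \<in> atlas M" "p \<in> fst c" "b \<in> model M"
  shows "coord_covector M c a p (coord_vector M c b p) = inner a b"
  using assms by (simp add: coord_covector_def coord_vector_mem_tangent_space coord_vector_self)

lemma vector_fields_cong:
  assumes "openin (mtop M) U" "X \<in> vector_fields M U" "\<And>q. q \<in> U \<Longrightarrow> X q = Y q"
  shows "Y \<in> vector_fields M U"
  unfolding vector_fields_def mem_Collect_eq
proof (intro conjI ballI)
  show "Y q \<in> tangent_space M q" if "q \<in> U" for q
    using vector_fields_mem[OF assms(2) that] assms(3)[OF that] by simp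
  fix d assume d: "d \<in> atlas M"
  show "smooth_fun M (U \<inter> fst d) (\<lambda>q. Y q d)"
    by (rule smooth_fun_cong[OF openin_Int[OF assms(1) openin_chart[OF d]]
          vector_fields_smooth[OF assms(2) d]]) (use assms(3) in auto)
qed

end

section \<open>The anchor map of a bivector field in coordinates\<close>

text \<open>Written with \<open>\<pi>\<close> rather than with the definite description
  \<open>sharp\<close>, so that smoothness is inherited from \<open>\<pi>\<close> on coordinate
  covectors; \<open>sharp_coord_covector\<close> identifies it as the coordinate form of
  \<open>sharp\<close>.\<close>

definition anchor_coord ::
  "('a, 'e::euclidean_space) mfd \<Rightarrow> ('a \<Rightarrow> ('a, 'e) covec \<Rightarrow> ('a, 'e) covec \<Rightarrow> real)
    \<Rightarrow> ('a, 'e) chart \<Rightarrow> 'a \<Rightarrow> 'e \<Rightarrow> 'e" where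
  "anchor_coord M \<pi> c q a =
     (\<Sum>b\<in>onb (model M). \<pi> q (coord_covector M c a q) (coord_covector M c b q) *\<^sub>R b)"

locale bivector_mfd = smooth_mfd M for M :: "('a, 'e::euclidean_space) mfd" +
  fixes \<pi> :: "'a \<Rightarrow> ('a, 'e) covec \<Rightarrow> ('a, 'e) covec \<Rightarrow> real"
  assumes bivector: "bivector_field M \<pi>"
begin

abbreviation "P \<equiv> anchor_coord M \<pi>"

lemma bivector_antisym:
  "p \<in> points M \<Longrightarrow> \<alpha> \<in> cotangent_space M p \<Longrightarrow> \<beta> \<in> cotangent_space M p \<Longrightarrow> \<pi> p \<alpha> \<beta> = - \<pi> p \<beta> \<alpha>"
  using bivector unfolding bivector_field_def by blast

lemma bivector_linear_form:
  "p \<in> points M \<Longrightarrow> \<alpha> \<in> cotangent_space M p \<Longrightarrow> linear_form (cotangent_space M p) (\<pi> p \<alpha>)"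
  using bivector unfolding bivector_field_def bilinear_form_def by blast

lemma anchor_mem_model: "P c q a \<in> model M"
  unfolding anchor_coord_def
  using onb_subset[OF subspace_model] by (auto intro!: subspace_sum subspace_scale subspace_model)

lemma cotangent_space_closed:
  assumes c: "c \<in> atlas M" "p \<in> fst c"
  shows "(\<lambda>_. 0) \<in> cotangent_space M p"
    and "\<alpha> \<in> cotangent_space M p \<Longrightarrow> \<beta> \<in> cotangent_space M p \<Longrightarrow> (\<lambda>v. \<alpha> v + \<beta> v) \<in> cotangent_space M p"
    and "\<alpha> \<in> cotangent_space M p \<Longrightarrow> (\<lambda>v. r *\<^sub>R \<alpha> v) \<in> cotangent_space M p"
proof -
  show "(\<lambda>_. 0) \<in> cotangent_space M p"
    using coord_covector_mem[OF c, of 0] by (simp only: coord_covector_zero)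
  assume "\<alpha> \<in> cotangent_space M p"
  then obtain a where a: "\<alpha> = coord_covector M c a p" by (rule cotangent_space_coord[OF c])
  show "(\<lambda>v. r *\<^sub>R \<alpha> v) \<in> cotangent_space M p"
    using coord_covector_mem[OF c, of "r *\<^sub>R a"] by (simp only: a coord_covector_scaleR)
  assume "\<beta> \<in> cotangent_space M p"
  then obtain b where b: "\<beta> = coord_covector M c b p" by (rule cotangent_space_coord[OF c])
  show "(\<lambda>v. \<alpha> v + \<beta> v) \<in> cotangent_space M p"
    using coord_covector_mem[OF c, of "a + b"] by (simp only: a b coord_covector_add)
qed

lemma inner_anchor:
  assumes c: "c \<in> atlas M" "q \<in> fst c"
  shows "inner f (P c q e) = \<pi> q (coord_covector M c e q) (coord_covector M c f q)"
proof -
  let ?B = "onb (model M)" and ?e = "coord_covector M c e q"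
  have q: "q \<in> points M" using chart_subset_points c by blast
  have f: "coord_covector M c f q = (\<lambda>v. \<Sum>b\<in>?B. inner f b *\<^sub>R coord_covector M c b q v)"
  proof
    fix v
    show "coord_covector M c f q v = (\<Sum>b\<in>?B. inner f b *\<^sub>R coord_covector M c b q v)"
    proof (cases "v \<in> tangent_space M q")
      case True
      have "inner f (v c) = inner f (\<Sum>b\<in>?B. inner b (v c) *\<^sub>R b)"
        by (simp add: onb_expansion[OF subspace_model tangent_vector_mem_model[OF True c]])
      then show ?thesis using True by (simp add: coord_covector_def inner_sum_right mult.commute)
    qed (simp add: coord_covector_def)
  qed
  have "\<pi> q ?e (coord_covector M c f q) = (\<Sum>b\<in>?B. inner f b * \<pi> q ?e (coord_covector M c b q))"
    unfolding f
    by (rule linear_form_sum[OF bivector_linear_form[OF q], THEN conjunct2])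
       (intro coord_covector_mem[OF c] cotangent_space_closed[OF c] finite_onb[OF subspace_model]; assumption)+
  then show ?thesis by (simp add: anchor_coord_def inner_sum_right mult.commute)
qed

lemma skew_anchor:
  assumes c: "c \<in> atlas M" "q \<in> fst c"
  shows "skew (P c q)"
proof -
  have q: "q \<in> points M" using chart_subset_points c by blast
  have sk: "inner a (P c q b) = - inner b (P c q a)" for a b
    using bivector_antisym[OF q coord_covector_mem[OF c, of b] coord_covector_mem[OF c, of a]]
    by (simp only: inner_anchor[OF c])
  \<comment> \<open>Skew-symmetry moves the argument of \<open>P c q\<close> into the linear left
    slot of the inner product.\<close>
  have "linear (P c q)"
  proof (rule linearI)
    fix a b :: 'e and r :: real
    have "inner f (P c q (a + b)) = inner f (P c q a + P c q b)" for f
      by (simp add: sk[of f] inner_add_left inner_add_right)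
    then show "P c q (a + b) = P c q a + P c q b" using vector_eq_ldot by blast
    have "inner f (P c q (r *\<^sub>R a)) = inner f (r *\<^sub>R P c q a)" for f
      by (simp add: sk[of f])
    then show "P c q (r *\<^sub>R a) = r *\<^sub>R P c q a" using vector_eq_ldot by blast
  qed
  with sk show ?thesis unfolding skew_def by blast
qed

text \<open>Resolves the definite description: coordinate covectors exhaust the cotangent space,
  which gives existence, and they separate representatives, which gives uniqueness.\<close>

lemma sharp_coord_covector:
  assumes c: "c \<in> atlas M" "q \<in> fst c"
  shows "sharp M \<pi> q (coord_covector M c e q) = coord_vector M c (P c q e) q"
  unfolding sharp_def
proof (rule the_equality)
  let ?v = "coord_vector M c (P c q e) q"
  have "\<beta> ?v = \<pi> q (coord_covector M c e q) \<beta>" if \<beta>: "\<beta> \<in> cotangent_space M q" for \<beta>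
  proof -
    obtain f where "\<beta> = coord_covector M c f q" using cotangent_space_coord[OF c \<beta>] .
    then show ?thesis
      by (simp add: coord_covector_coord_vector[OF c] anchor_mem_model inner_anchor[OF c])
  qed
  then show "?v \<in> tangent_space M q \<and> (\<forall>\<beta>\<in>cotangent_space M q. \<beta> ?v = \<pi> q (coord_covector M c e q) \<beta>)"
    using coord_vector_mem_tangent_space[OF c anchor_mem_model] by blast
next
  fix v assume v: "v \<in> tangent_space M q \<and>
    (\<forall>\<beta>\<in>cotangent_space M q. \<beta> v = \<pi> q (coord_covector M c e q) \<beta>)"
  have "inner f (v c) = inner f (P c q e)" for f
    using v coord_covector_mem[OF c, of f] by (simp add: inner_anchor[OF c]) (simp add: coord_covector_def)
  then have "v c = P c q e" using vector_eq_ldot by blast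
  then show "v = coord_vector M c (P c q e) q" using tangent_vector_eq[of v q c] v c by auto
qed

lemma smooth_bivector_coord:
  assumes "c \<in> atlas M"
  shows "smooth_fun M (fst c) (\<lambda>q. \<pi> q (coord_covector M c e q) (coord_covector M c f q))"
  using bivector openin_chart[OF assms] coord_covector_one_form[OF assms]
  unfolding bivector_field_def by blast

lemma smooth_anchor:
  assumes "c \<in> atlas M"
  shows "smooth_fun M (fst c) (\<lambda>q. P c q e)"
  unfolding anchor_coord_def
  by (rule smooth_fun_sum[OF openin_chart[OF assms] finite_onb[OF subspace_model]
        smooth_fun_linear[OF openin_chart[OF assms] smooth_bivector_coord[OF assms] bounded_linear_scaleR_left]])

text \<open>Makes this field an admissible direction for \<open>form_connection\<close>, as
  compatibility requires.\<close>

lemma sharp_coord_field: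
  assumes c: "c \<in> atlas M"
  shows "(\<lambda>q. sharp M \<pi> q (coord_covector M c e q)) \<in> vector_fields M (fst c)"
proof (rule vector_fields_cong[OF openin_chart[OF c]])
  let ?B = "onb (model M)"
  show "(\<lambda>q d. \<Sum>b\<in>?B. \<pi> q (coord_covector M c e q) (coord_covector M c b q) *\<^sub>R coord_vector M c b q d)
      \<in> vector_fields M (fst c)"
    using onb_subset[OF subspace_model]
    by (intro vector_fields_sum openin_chart[OF c] finite_onb[OF subspace_model]
        smooth_bivector_coord[OF c] coord_vector_field[OF c]) auto
  show "(\<lambda>d. \<Sum>b\<in>?B. \<pi> q (coord_covector M c e q) (coord_covector M c b q) *\<^sub>R coord_vector M c b q d)
      = sharp M \<pi> q (coord_covector M c e q)" if q: "q \<in> fst c" for q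
    using coord_vector_sum[OF c q, where a="\<lambda>b. b"]
    by (simp add: sharp_coord_covector[OF c q]) (simp add: anchor_coord_def)
qed

lemma sharp_image:
  assumes c: "c \<in> atlas M" "q \<in> fst c"
  shows "sharp M \<pi> q ` cotangent_space M q = (\<lambda>a. coord_vector M c a q) ` range (P c q)"
proof -
  have "cotangent_space M q = range (\<lambda>e. coord_covector M c e q)"
    by (auto intro: coord_covector_mem[OF c] elim: cotangent_space_coord[OF c])
  then show ?thesis by (simp add: image_image sharp_coord_covector[OF c])
qed

end

locale compatible_mfd = affine_mfd M D + bivector_mfd M \<pi>
  for M :: "('a, 'e::euclidean_space) mfd" and D \<pi> +
  assumes compatible: "pi_compatible M D \<pi>"
begin

abbreviation "\<Gamma> \<equiv> christoffel M D"

text \<open>The coordinate representative of \<open>D\<^sub>X (coord_covector e)\<close> where \<open>X\<close> has representative \<open>x\<close>.\<close>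

definition covector_deriv :: "('a, 'e) chart \<Rightarrow> 'a \<Rightarrow> 'e \<Rightarrow> 'e \<Rightarrow> 'e" where
  "covector_deriv c p x e = - (\<Sum>b\<in>onb (model M). inner e (\<Gamma> c p x b) *\<^sub>R b)"

lemma inner_covector_deriv:
  assumes c: "c \<in> atlas M" "p \<in> fst c" and xy: "x \<in> model M" "y \<in> model M"
  shows "inner (covector_deriv c p x e) y = - inner e (\<Gamma> c p x y)"
  by (simp add: covector_deriv_def christoffel_linear_right[OF c xy] inner_sum_left inner_sum_right
      mult.commute)

text \<open>A coordinate covector has constant coefficients, so in
  \<open>X \<cdot> \<beta>(Y) - \<beta>(D X Y)\<close> the derivatives of the component of
  \<open>Y\<close> cancel and only the Christoffel term survives.\<close>

lemma form_connection_coord_covector: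
  assumes c: "c \<in> atlas M" "p \<in> fst c" and X: "X \<in> vector_fields M (fst c)"
  shows "form_connection M D X (coord_covector M c e) p
    = coord_covector M c (covector_deriv c p (X p c) e) p"
  unfolding form_connection_def
proof (rule the_equality)
  let ?h = "covector_deriv c p (X p c) e"
  have Xp: "X p \<in> tangent_space M p" by (rule vector_fields_mem[OF X c(2)])
  have h: "coord_covector M c ?h p (Y p) =
      dirder M (\<lambda>q. coord_covector M c e q (Y q)) p (X p) - coord_covector M c e p (D X Y p)"
    if U: "openin (mtop M) U" "p \<in> U" and Y: "Y \<in> vector_fields M U" for U Y
  proof -
    let ?W = "U \<inter> fst c"
    have W: "openin (mtop M) ?W" "p \<in> ?W" using U c openin_chart[OF c(1)] by auto
    have X': "X \<in> vector_fields M ?W" and Y': "Y \<in> vector_fields M ?W"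
      using X Y vector_fields_subset by blast+
    note Yp = vector_fields_mem[OF Y U(2)]
    have sY: "smooth_fun M ?W (\<lambda>q. Y q c)" using vector_fields_smooth[OF Y c(1)] .
    have "dirder M (\<lambda>q. coord_covector M c e q (Y q)) p (X p) = dirder M (\<lambda>q. inner e (Y q c)) p (X p)"
      by (rule dirder_cong[OF W Xp, symmetric])
         (use smooth_component[OF W(1) Y' c(1)] vector_fields_mem[OF Y] in \<open>auto simp: coord_covector_def\<close>)
    also have "\<dots> = inner e (dirder M (\<lambda>q. Y q c) p (X p))"
      by (rule dirder_linear[OF W Xp sY bounded_linear_inner_right])
    finally have 1: "dirder M (\<lambda>q. coord_covector M c e q (Y q)) p (X p)
      = inner e (dirder M (\<lambda>q. Y q c) p (X p))" .
    have 2: "coord_covector M c e p (D X Y p) = inner e (D X Y p c)"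
      using vector_fields_mem[OF connection_mem[OF W(1) X' Y'] W(2)] by (simp add: coord_covector_def)
    have 3: "coord_covector M c ?h p (Y p) = - inner e (\<Gamma> c p (X p c) (Y p c))"
      using Yp Xp by (simp add: coord_covector_def inner_covector_deriv[OF c] tangent_vector_mem_model c)
    show ?thesis
      unfolding 1 2 3 connection_coord[OF W c X' Y'] by (simp add: inner_add_right)
  qed
  then show "coord_covector M c ?h p \<in> cotangent_space M p \<and>
      (\<forall>U Y. openin (mtop M) U \<and> p \<in> U \<and> Y \<in> vector_fields M U \<longrightarrow> coord_covector M c ?h p (Y p) =
      dirder M (\<lambda>q. coord_covector M c e q (Y q)) p (X p) - coord_covector M c e p (D X Y p))"
    using coord_covector_mem[OF c] by blast
  fix \<theta> assume \<theta>: "\<theta> \<in> cotangent_space M p \<and>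
      (\<forall>U Y. openin (mtop M) U \<and> p \<in> U \<and> Y \<in> vector_fields M U \<longrightarrow> \<theta> (Y p) =
      dirder M (\<lambda>q. coord_covector M c e q (Y q)) p (X p) - coord_covector M c e p (D X Y p))"
  show "\<theta> = coord_covector M c ?h p"
  proof
    fix v
    show "\<theta> v = coord_covector M c ?h p v"
    proof (cases "v \<in> tangent_space M p")
      case True
      \<comment> \<open>Every tangent vector is the value of a coordinate field, so the defining
        equation determines the covector.\<close>
      let ?Y = "coord_vector M c (v c)"
      have Y: "?Y \<in> vector_fields M (fst c)"
        by (rule coord_vector_field[OF c(1) tangent_vector_mem_model[OF True c]])
      have "\<theta> (?Y p) = coord_covector M c ?h p (?Y p)"
        using \<theta> h[OF openin_chart[OF c(1)] c(2) Y] openin_chart[OF c(1)] c(2) Y by metis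
      then show ?thesis by (simp add: tangent_vector_eq[OF True c])
    next
      case False
      then show ?thesis using \<theta> by (simp add: cotangent_space_def coord_covector_def)
    qed
  qed
qed

text \<open>Compatibility evaluated on three coordinate covectors. The direction has to be the sharp
  of a covector, which is why \<open>x\<close> is taken in \<open>range (P c p)\<close>.\<close>

lemma anchor_derivative:
  assumes c: "c \<in> atlas M" "p \<in> fst c" and x: "x \<in> range (P c p)"
  defines "v \<equiv> coord_vector M c x p"
  shows "inner f (dirder M (\<lambda>q. P c q e) p v) = inner e (\<Gamma> c p x (P c p f)) - inner f (\<Gamma> c p x (P c p e))"
proof -
  obtain a where a: "x = P c p a" using x by blast
  let ?X = "\<lambda>q. sharp M \<pi> q (coord_covector M c a q)"
  have Xp: "?X p = v" by (simp add: v_def a sharp_coord_covector[OF c])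
  have xm: "x \<in> model M" by (simp add: a anchor_mem_model)
  have v: "v \<in> tangent_space M p" "v c = x"
    unfolding v_def using coord_vector_mem_tangent_space[OF c xm] coord_vector_self[OF c xm] by auto
  note X = sharp_coord_field[OF c(1), of a]
  note op = openin_chart[OF c(1)]
  have "dirder M (\<lambda>q. \<pi> q (coord_covector M c e q) (coord_covector M c f q)) p (?X p)
     - \<pi> p (form_connection M D ?X (coord_covector M c e) p) (coord_covector M c f p)
     - \<pi> p (coord_covector M c e p) (form_connection M D ?X (coord_covector M c f) p) = 0"
    using compatible op c(2) coord_covector_one_form[OF c(1)] unfolding pi_compatible_def Let_def by blast
  then have "dirder M (\<lambda>q. \<pi> q (coord_covector M c e q) (coord_covector M c f q)) p v =
      inner f (P c p (covector_deriv c p x e)) + inner (covector_deriv c p x f) (P c p e)"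
    by (simp add: form_connection_coord_covector[OF c X] Xp v inner_anchor[OF c])
  moreover have "inner f (P c p (covector_deriv c p x e)) = - inner (covector_deriv c p x e) (P c p f)"
    using skew_anchor[OF c] unfolding skew_def by blast
  moreover have "dirder M (\<lambda>q. \<pi> q (coord_covector M c e q) (coord_covector M c f q)) p v
      = dirder M (\<lambda>q. inner f (P c q e)) p v"
    by (rule dirder_cong[OF op c(2) v(1) smooth_bivector_coord[OF c(1)]]) (simp add: inner_anchor[OF c(1)])
  moreover have "\<dots> = inner f (dirder M (\<lambda>q. P c q e) p v)"
    by (rule dirder_linear[OF op c(2) v(1) smooth_anchor[OF c(1)] bounded_linear_inner_right])
  ultimately show ?thesis by (simp add: inner_covector_deriv[OF c xm anchor_mem_model])
qed

text \<open>In directions tangent to the leaf, \<open>sharp\<close> commutes with covariant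
  differentiation: the left-hand side equals \<open>P c p\<close> of the covariant derivative of the
  covector \<open>e\<close>.\<close>

lemma anchor_derivative_range:
  assumes c: "c \<in> atlas M" "p \<in> fst c" and x: "x \<in> range (P c p)"
  shows "dirder M (\<lambda>q. P c q e) p (coord_vector M c x p) + \<Gamma> c p x (P c p e) \<in> range (P c p)"
proof -
  have xm: "x \<in> model M" using x anchor_mem_model by blast
  have "inner f (dirder M (\<lambda>q. P c q e) p (coord_vector M c x p) + \<Gamma> c p x (P c p e))
      = inner f (P c p (covector_deriv c p x e))" for f
  proof -
    have "inner f (P c p (covector_deriv c p x e)) = - inner (covector_deriv c p x e) (P c p f)"
      using skew_anchor[OF c] unfolding skew_def by blast
    then show ?thesis
      by (simp add: anchor_derivative[OF c x] inner_covector_deriv[OF c xm anchor_mem_model] inner_add_right)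
  qed
  then have "dirder M (\<lambda>q. P c q e) p (coord_vector M c x p) + \<Gamma> c p x (P c p e)
      = P c p (covector_deriv c p x e)" using vector_eq_ldot by blast
  then show ?thesis by simp
qed

end

section \<open>Integral manifolds of the characteristic distribution\<close>

locale integral_mfd = compatible_mfd M D \<pi> + S: smooth_mfd S
  for M :: "('a, 'e::euclidean_space) mfd" and D \<pi> and S :: "('a, 'e) mfd" +
  assumes immersed: "immersed_submanifold S M"
    and tangent: "\<And>p. p \<in> points S \<Longrightarrow> sub_tangent_space S M p = sharp M \<pi> p ` cotangent_space M p"
begin

section \<open>The inclusion of the leaf in charts\<close>

definition incl_deriv :: "('a, 'e) chart \<Rightarrow> ('a, 'e) chart \<Rightarrow> 'a \<Rightarrow> 'e \<Rightarrow> 'e" where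
  "incl_deriv c \<sigma> q = frechet_derivative (snd c \<circ> chart_inv \<sigma>) (at (snd \<sigma> q) within model S)"

text \<open>The leaf topology can be strictly finer than the induced one; continuity of the
  inclusion provides this direction.\<close>

lemma openin_leaf_chart:
  assumes "c \<in> atlas M"
  shows "openin (mtop S) (points S \<inter> fst c)"
proof -
  have "continuous_map (mtop S) (mtop M) id"
    using immersed by (simp add: immersed_submanifold_def smooth_map_def)
  from openin_continuous_map_preimage[OF this openin_chart[OF assms]] show ?thesis
    by (simp add: Int_def)
qed

lemma incl_smooth:
  assumes "c \<in> atlas M" "\<sigma> \<in> atlas S"
  shows "smooth_on (model S) (snd \<sigma> ` (fst \<sigma> \<inter> fst c)) (snd c \<circ> chart_inv \<sigma>)"
  using immersed assms by (simp add: immersed_submanifold_def smooth_map_def Int_def)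

lemma incl_has_derivative:
  assumes c: "c \<in> atlas M" "p \<in> fst c" and \<sigma>: "\<sigma> \<in> atlas S" "p \<in> fst \<sigma>"
  shows "(snd c \<circ> chart_inv \<sigma> has_derivative incl_deriv c \<sigma> p) (at (snd \<sigma> p) within model S)"
  unfolding incl_deriv_def by (rule smooth_onD[OF incl_smooth[OF c(1) \<sigma>(1)]]) (use c \<sigma> in auto)

lemma incl_apply:
  assumes c: "c \<in> atlas M" "p \<in> fst c" and \<sigma>: "\<sigma> \<in> atlas S" "p \<in> fst \<sigma>"
    and v: "v \<in> tangent_space S p"
  shows "incl_map S M p v c = incl_deriv c \<sigma> p (v \<sigma>)"
  using S.dirder_eq[OF \<sigma> v incl_has_derivative[OF c \<sigma>]] c by (simp add: tangent_map_def charts_at_iff)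

lemma has_derivative_along_incl:
  assumes c: "c \<in> atlas M" "p \<in> fst c" and \<sigma>: "\<sigma> \<in> atlas S" "p \<in> fst \<sigma>"
    and f: "(f \<circ> chart_inv c has_derivative f') (at (snd c p) within model M)"
  shows "(f \<circ> chart_inv \<sigma> has_derivative (\<lambda>x. f' (incl_deriv c \<sigma> p x))) (at (snd \<sigma> p) within model S)"
proof -
  let ?A = "snd \<sigma> ` (fst \<sigma> \<inter> (points S \<inter> fst c))"
  have p: "p \<in> points S" using S.chart_subset_points \<sigma> by blast
  have A: "openin (top_of_set (model S)) ?A" "snd \<sigma> p \<in> ?A"
    using S.openin_chart_image[OF \<sigma>(1) openin_leaf_chart[OF c(1)]] c \<sigma> p by auto
  note f' = f[unfolded comp_def]
  have "((\<lambda>x. (f \<circ> chart_inv c) ((snd c \<circ> chart_inv \<sigma>) x)) has_derivative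
      (\<lambda>x. f' (incl_deriv c \<sigma> p x))) (at (snd \<sigma> p) within model S)"
    by (rule has_derivative_compose_openin[OF A incl_has_derivative[OF c \<sigma>], where W="model M"])
       (use c \<sigma> f' in \<open>auto simp: S.chart_inv_chart chart_mem_model\<close>)
  then show ?thesis
    by (rule has_derivative_transform_openin[OF A, rotated])
       (use c \<sigma> in \<open>auto simp: S.chart_inv_chart chart_inv_chart\<close>)
qed

lemma sub_tangent_space_coord:
  assumes c: "c \<in> atlas M" "q \<in> fst c" and q: "q \<in> points S"
  shows "sub_tangent_space S M q = (\<lambda>a. coord_vector M c a q) ` range (P c q)"
  using tangent[OF q] sharp_image[OF c] by simp

lemma sub_tangent_space_component:
  assumes c: "c \<in> atlas M" "q \<in> fst c" and q: "q \<in> points S" and v: "v \<in> sub_tangent_space S M q"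
  shows "v c \<in> range (P c q)" "v \<in> tangent_space M q"
  using v coord_vector_self[OF c anchor_mem_model[of c q]] coord_vector_mem_tangent_space[OF c anchor_mem_model[of c q]]
  by (auto simp: sub_tangent_space_coord[OF c q])

lemma incl_component:
  assumes c: "c \<in> atlas M" "q \<in> fst c" and q: "q \<in> points S" and v: "v \<in> tangent_space S q"
  shows "incl_map S M q v c \<in> range (P c q)" "incl_map S M q v \<in> tangent_space M q"
  using sub_tangent_space_component[OF c q, of "incl_map S M q v"] v by (auto simp: sub_tangent_space_def)

lemma range_anchor:
  assumes c: "c \<in> atlas M" "q \<in> fst c" and \<sigma>: "\<sigma> \<in> atlas S" "q \<in> fst \<sigma>"
  shows "range (P c q) = incl_deriv c \<sigma> q ` model S"
proof -
  have q: "q \<in> points S" using S.chart_subset_points \<sigma> by blast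
  have "(\<lambda>v. v c) ` sub_tangent_space S M q = range (P c q)"
    using coord_vector_self[OF c anchor_mem_model[of c q]]
    by (simp add: sub_tangent_space_coord[OF c q] image_image)
  moreover have "(\<lambda>v. v c) ` sub_tangent_space S M q = incl_deriv c \<sigma> q ` (\<lambda>v. v \<sigma>) ` tangent_space S q"
    by (simp add: sub_tangent_space_def image_image incl_apply[OF c \<sigma>])
  moreover have "(\<lambda>v. v \<sigma>) ` tangent_space S q = model S"
  proof
    show "model S \<subseteq> (\<lambda>v. v \<sigma>) ` tangent_space S q"
    proof
      fix a assume a: "a \<in> model S"
      show "a \<in> (\<lambda>v. v \<sigma>) ` tangent_space S q"
        using S.coord_vector_self[OF \<sigma> a] S.coord_vector_mem_tangent_space[OF \<sigma> a] by (metis imageI)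
    qed
  qed (use S.tangent_vector_mem_model[OF _ \<sigma>] in auto)
  ultimately show ?thesis by simp
qed

text \<open>Source of constant rank: the range is the image of the fixed space
  \<open>model S\<close> under the derivative of the inclusion, which is injective because the leaf
  is immersed.\<close>

lemma dim_range_anchor:
  assumes c: "c \<in> atlas M" "q \<in> fst c" and \<sigma>: "\<sigma> \<in> atlas S" "q \<in> fst \<sigma>"
  shows "dim (range (P c q)) = dim (model S)"
proof -
  have q: "q \<in> points S" using S.chart_subset_points \<sigma> by blast
  have lin: "linear (incl_deriv c \<sigma> q)"
    using has_derivative_bounded_linear[OF incl_has_derivative[OF c \<sigma>]] bounded_linear.linear by blast
  have "inj_on (incl_deriv c \<sigma> q) (model S)"
  proof (rule inj_onI)
    fix a b assume ab: "a \<in> model S" "b \<in> model S" "incl_deriv c \<sigma> q a = incl_deriv c \<sigma> q b"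
    let ?E = "\<lambda>a. coord_vector S \<sigma> a q"
    have E: "?E a \<in> tangent_space S q" "?E b \<in> tangent_space S q" "?E a \<sigma> = a" "?E b \<sigma> = b"
      using ab \<sigma> by (auto intro: S.coord_vector_mem_tangent_space S.coord_vector_self)
    have "incl_map S M q (?E a) = incl_map S M q (?E b)"
      by (rule tangent_vector_eqI[OF incl_component(2)[OF c q] incl_component(2)[OF c q] c])
         (use E ab incl_apply[OF c \<sigma>] in auto)
    moreover have "inj_on (incl_map S M q) (tangent_space S q)"
      using immersed q by (simp add: immersed_submanifold_def)
    ultimately have "?E a = ?E b" using E by (meson inj_onD)
    then show "a = b" using E by metis
  qed
  then show ?thesis
    using dim_image_eq[OF lin, of "model S"] S.subspace_model
    by (simp add: range_anchor[OF c \<sigma>] span_eq_iff[THEN iffD2])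
qed

lemma skew_family_anchor:
  assumes c: "c \<in> atlas M" "p \<in> fst c" and \<sigma>: "\<sigma> \<in> atlas S" "p \<in> fst \<sigma>"
  shows "skew_family (model S) (snd \<sigma> p) (\<lambda>s. P c (chart_inv \<sigma> s))
    (\<lambda>e x. frechet_derivative ((\<lambda>q. P c q e) \<circ> chart_inv c) (at (snd c p) within model M)
       (incl_deriv c \<sigma> p x))"
proof
  have p: "p \<in> points S" using S.chart_subset_points \<sigma> by blast
  note ev = S.eventually_chart_inv[OF \<sigma> openin_leaf_chart[OF c(1)]]
  have ev: "\<forall>\<^sub>F s in at (snd \<sigma> p) within model S. chart_inv \<sigma> s \<in> fst \<sigma> \<inter> fst c"
    by (rule eventually_mono[OF ev]) (use p c in auto)
  have inv: "chart_inv \<sigma> (snd \<sigma> p) = p" using \<sigma> by (rule S.chart_inv_chart)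
  show "subspace (model S)" by (rule S.subspace_model)
  show "snd \<sigma> p \<in> model S" by (rule S.chart_mem_model[OF \<sigma>])
  show "\<forall>\<^sub>F s in at (snd \<sigma> p) within model S. skew (P c (chart_inv \<sigma> s))"
    using ev by eventually_elim (use skew_anchor c in auto)
  show "skew (P c (chart_inv \<sigma> (snd \<sigma> p)))" unfolding inv by (rule skew_anchor[OF c])
  show "((\<lambda>s. P c (chart_inv \<sigma> s) e) has_derivative
     (\<lambda>x. frechet_derivative ((\<lambda>q. P c q e) \<circ> chart_inv c) (at (snd c p) within model M)
       (incl_deriv c \<sigma> p x))) (at (snd \<sigma> p) within model S)" for e
    using has_derivative_along_incl[OF c \<sigma> smooth_fun_has_derivative[OF smooth_anchor[OF c(1)] c c(2)], of e]
    by (simp add: comp_def)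
  show "\<forall>\<^sub>F s in at (snd \<sigma> p) within model S.
      dim (range (P c (chart_inv \<sigma> s))) = dim (range (P c (chart_inv \<sigma> (snd \<sigma> p))))"
    using ev by eventually_elim (use dim_range_anchor c \<sigma> inv in auto)
qed

lemma dirder_anchor:
  assumes c: "c \<in> atlas M" "p \<in> fst c" and \<sigma>: "\<sigma> \<in> atlas S" "p \<in> fst \<sigma>"
    and v: "v \<in> tangent_space S p"
  shows "dirder M (\<lambda>q. P c q e) p (coord_vector M c (incl_map S M p v c) p) =
    frechet_derivative ((\<lambda>q. P c q e) \<circ> chart_inv c) (at (snd c p) within model M)
       (incl_deriv c \<sigma> p (v \<sigma>))"
proof -
  have p: "p \<in> points S" using S.chart_subset_points \<sigma> by blast
  have "incl_map S M p v c \<in> model M" using incl_component(1)[OF c p v] anchor_mem_model[of c p] by auto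
  then show ?thesis
    using dirder_eq[OF c coord_vector_mem_tangent_space[OF c]
        smooth_fun_has_derivative[OF smooth_anchor[OF c(1)] c c(2)]]
    by (simp add: coord_vector_self[OF c] incl_apply[OF c \<sigma> v])
qed

lemma eventually_chart_inv_leaf:
  assumes c: "c \<in> atlas M" "p \<in> fst c" and \<sigma>: "\<sigma> \<in> atlas S" "p \<in> fst \<sigma>"
    and W: "openin (mtop S) W" "p \<in> W"
  shows "\<forall>\<^sub>F s in at (snd \<sigma> p) within model S. chart_inv \<sigma> s \<in> W \<inter> fst c"
proof -
  have "p \<in> points S" using S.chart_subset_points \<sigma> by blast
  then have "\<forall>\<^sub>F s in at (snd \<sigma> p) within model S.
      chart_inv \<sigma> s \<in> fst \<sigma> \<inter> (W \<inter> (points S \<inter> fst c)) \<and> snd \<sigma> (chart_inv \<sigma> s) = s"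
    using c W by (intro S.eventually_chart_inv[OF \<sigma>] openin_Int openin_leaf_chart) auto
  then show ?thesis by (rule eventually_mono) auto
qed

section \<open>Covariant derivatives of fields along the leaf\<close>

text \<open>\<open>Z\<close> is compared with \<open>P e\<close>, where
  \<open>Z p = P c p e\<close>. The derivatives differ by an element of the range, and compatibility
  puts the covariant derivative of \<open>P e\<close> there; the Christoffel terms coincide because
  the two fields agree at \<open>p\<close>.\<close>

lemma covariant_derivative_in_range:
  assumes c: "c \<in> atlas M" "p \<in> fst c" and \<sigma>: "\<sigma> \<in> atlas S" "p \<in> fst \<sigma>"
    and W: "openin (mtop S) W" "p \<in> W"
    and Z: "\<And>q. q \<in> W \<Longrightarrow> q \<in> fst c \<Longrightarrow> Z q \<in> range (P c q)"
      "(Z \<circ> chart_inv \<sigma> has_derivative Z') (at (snd \<sigma> p) within model S)"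
    and v: "v \<in> tangent_space S p"
  shows "Z' (v \<sigma>) + \<Gamma> c p (incl_map S M p v c) (Z p) \<in> range (P c p)"
proof -
  let ?x = "incl_map S M p v c"
  have p: "p \<in> points S" using S.chart_subset_points \<sigma> by blast
  have inv: "chart_inv \<sigma> (snd \<sigma> p) = p" using \<sigma> by (rule S.chart_inv_chart)
  obtain e where e: "Z p = P c p e" using Z(1)[OF W(2) c(2)] by auto
  have ev: "\<forall>\<^sub>F s in at (snd \<sigma> p) within model S. (Z \<circ> chart_inv \<sigma>) s \<in> range (P c (chart_inv \<sigma> s))"
    using eventually_chart_inv_leaf[OF c \<sigma> W] by eventually_elim (use Z(1) in auto)
  have "Z' (v \<sigma>) - dirder M (\<lambda>q. P c q e) p (coord_vector M c ?x p) \<in> range (P c p)"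
    using skew_family.derivative_diff_in_range[OF skew_family_anchor[OF c \<sigma>] Z(2) ev _
        S.tangent_vector_mem_model[OF v \<sigma>], of e]
    by (simp only: dirder_anchor[OF c \<sigma> v] comp_apply inv e)
  moreover have "dirder M (\<lambda>q. P c q e) p (coord_vector M c ?x p) + \<Gamma> c p ?x (Z p) \<in> range (P c p)"
    unfolding e by (rule anchor_derivative_range[OF c incl_component(1)[OF c p v]])
  moreover have "subspace (range (P c p))"
    using skew_anchor[OF c] by (auto simp: skew_def intro: linear_subspace_image)
  ultimately have "(Z' (v \<sigma>) - dirder M (\<lambda>q. P c q e) p (coord_vector M c ?x p)) +
      (dirder M (\<lambda>q. P c q e) p (coord_vector M c ?x p) + \<Gamma> c p ?x (Z p)) \<in> range (P c p)"
    by (metis subspace_add)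
  then show ?thesis by (simp only: add.assoc[symmetric] diff_add_cancel)
qed

text \<open>The derivative of the pairing still contains the derivative of \<open>P l\<close>.
  Compatibility replaces it by two Christoffel terms, exactly those that complete \<open>Y'\<close>
  and \<open>Z'\<close> to covariant derivatives.\<close>

lemma dirder_pairing:
  assumes c: "c \<in> atlas M" "p \<in> fst c" and \<sigma>: "\<sigma> \<in> atlas S" "p \<in> fst \<sigma>"
    and W: "openin (mtop S) W" "p \<in> W"
    and Y: "\<And>q. q \<in> W \<Longrightarrow> q \<in> fst c \<Longrightarrow> Y q \<in> range (P c q)"
      "(Y \<circ> chart_inv \<sigma> has_derivative Y') (at (snd \<sigma> p) within model S)"
    and Z: "\<And>q. q \<in> W \<Longrightarrow> q \<in> fst c \<Longrightarrow> Z q \<in> range (P c q)"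
      "(Z \<circ> chart_inv \<sigma> has_derivative Z') (at (snd \<sigma> p) within model S)"
    and v: "v \<in> tangent_space S p"
    and w: "\<And>q k l. q \<in> W \<Longrightarrow> q \<in> fst c \<Longrightarrow> P c q k = Y q \<Longrightarrow> P c q l = Z q \<Longrightarrow> w q = inner l (P c q k)"
    and k: "P c p k = Y p" and l: "P c p l = Z p"
  shows "dirder S w p v = inner l (Y' (v \<sigma>) + \<Gamma> c p (incl_map S M p v c) (Y p))
    - inner k (Z' (v \<sigma>) + \<Gamma> c p (incl_map S M p v c) (Z p))"
proof -
  let ?x = "incl_map S M p v c"
  have p: "p \<in> points S" using S.chart_subset_points \<sigma> by blast
  have inv: "chart_inv \<sigma> (snd \<sigma> p) = p" using \<sigma> by (rule S.chart_inv_chart)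
  note ev = eventually_chart_inv_leaf[OF c \<sigma> W]
  have evY: "\<forall>\<^sub>F s in at (snd \<sigma> p) within model S. (Y \<circ> chart_inv \<sigma>) s \<in> range (P c (chart_inv \<sigma> s))"
    using ev by eventually_elim (use Y(1) in auto)
  have evZ: "\<forall>\<^sub>F s in at (snd \<sigma> p) within model S. (Z \<circ> chart_inv \<sigma>) s \<in> range (P c (chart_inv \<sigma> s))"
    using ev by eventually_elim (use Z(1) in auto)
  have evw: "\<forall>\<^sub>F s in at (snd \<sigma> p) within model S. \<forall>k l. P c (chart_inv \<sigma> s) k = (Y \<circ> chart_inv \<sigma>) s \<and>
      P c (chart_inv \<sigma> s) l = (Z \<circ> chart_inv \<sigma>) s \<longrightarrow>
      (w \<circ> chart_inv \<sigma>) s = inner l (P c (chart_inv \<sigma> s) k)"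
    using ev by eventually_elim (use w in auto)
  have "(w \<circ> chart_inv \<sigma> has_derivative (\<lambda>x. inner l (Y' x) - inner k (Z' x) + inner k
     (frechet_derivative ((\<lambda>q. P c q l) \<circ> chart_inv c) (at (snd c p) within model M)
       (incl_deriv c \<sigma> p x)))) (at (snd \<sigma> p) within model S)"
    by (rule skew_family.pairing_has_derivative[OF skew_family_anchor[OF c \<sigma>] Y(2) evY _ Z(2) evZ _ evw])
       (simp_all add: inv k l w[OF W(2) c(2) k l] flip: k l)
  from S.dirder_eq[OF \<sigma> v this]
  have "dirder S w p v = inner l (Y' (v \<sigma>)) - inner k (Z' (v \<sigma>)) + inner k
      (dirder M (\<lambda>q. P c q l) p (coord_vector M c ?x p))"
    by (simp only: dirder_anchor[OF c \<sigma> v])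
  then show ?thesis
    using anchor_derivative[OF c incl_component(1)[OF c p v], of k l] by (simp add: k l inner_add_right)
qed

text \<open>The component is the derivative of the inclusion applied to a varying vector. Expanding
  that vector in \<open>onb (model S)\<close> leaves products of smooth coefficients with
  derivatives of the inclusion in fixed directions.\<close>

lemma incl_field_has_derivative:
  assumes c: "c \<in> atlas M" "p \<in> fst c" and \<sigma>: "\<sigma> \<in> atlas S" "p \<in> fst \<sigma>"
    and W: "openin (mtop S) W" "p \<in> W" and Y: "Y \<in> vector_fields S W"
  obtains Z' where "((\<lambda>q. incl_map S M q (Y q) c) \<circ> chart_inv \<sigma> has_derivative Z')
    (at (snd \<sigma> p) within model S)"
proof -
  let ?B = "onb (model S)" and ?F = "at (snd \<sigma> p) within model S"
  let ?\<iota> = "snd c \<circ> chart_inv \<sigma>"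
  let ?J = "\<lambda>b s. frechet_derivative ?\<iota> (at s within model S) b"
  let ?y = "\<lambda>b. (\<lambda>q. inner b (Y q \<sigma>)) \<circ> chart_inv \<sigma>"
  have W': "openin (mtop S) (W \<inter> fst \<sigma>)" "p \<in> W \<inter> fst \<sigma>" using W \<sigma> S.openin_chart[OF \<sigma>(1)] by auto
  have Y': "Y \<in> vector_fields S (W \<inter> fst \<sigma>)" by (rule S.vector_fields_subset[OF Y]) auto
  have "\<exists>y'. (?y b has_derivative y') ?F" for b
    using S.smooth_fun_has_derivative[OF S.smooth_component[OF W'(1) Y' \<sigma>(1)] \<sigma> W'(2)] by auto
  then obtain y' where y': "\<And>b. (?y b has_derivative y' b) ?F" by metis
  have "\<exists>J'. (?J b has_derivative J') ?F" if "b \<in> ?B" for b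
    using smooth_onD[OF smooth_on_frechet_derivative[OF incl_smooth[OF c(1) \<sigma>(1)]], of b "snd \<sigma> p"]
      onb_subset[OF S.subspace_model] that c \<sigma> by blast
  then obtain J' where J': "\<And>b. b \<in> ?B \<Longrightarrow> (?J b has_derivative J' b) ?F" by metis
  have der: "((\<lambda>s. \<Sum>b\<in>?B. ?y b s *\<^sub>R ?J b s) has_derivative
      (\<lambda>h. \<Sum>b\<in>?B. ?y b (snd \<sigma> p) *\<^sub>R J' b h + y' b h *\<^sub>R ?J b (snd \<sigma> p))) ?F"
    by (intro has_derivative_sum has_derivative_scaleR y' J')
  have A: "openin (top_of_set (model S)) (snd \<sigma> ` (fst \<sigma> \<inter> (W \<inter> (points S \<inter> fst c))))"
    by (intro S.openin_chart_image \<sigma> openin_Int W openin_leaf_chart c)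
  have pA: "snd \<sigma> p \<in> snd \<sigma> ` (fst \<sigma> \<inter> (W \<inter> (points S \<inter> fst c)))"
    using c \<sigma> W S.chart_subset_points[OF \<sigma>(1)] by auto
  have eq: "(\<Sum>b\<in>?B. ?y b s *\<^sub>R ?J b s) = ((\<lambda>q. incl_map S M q (Y q) c) \<circ> chart_inv \<sigma>) s"
    if s: "s \<in> snd \<sigma> ` (fst \<sigma> \<inter> (W \<inter> (points S \<inter> fst c)))" for s
  proof -
    obtain q where q: "q \<in> fst \<sigma>" "q \<in> W" "q \<in> fst c" "s = snd \<sigma> q" using s by blast
    note Yq = S.vector_fields_mem[OF Y q(2)]
    have lin: "linear (incl_deriv c \<sigma> q)"
      using has_derivative_bounded_linear[OF incl_has_derivative[OF c(1) q(3) \<sigma>(1) q(1)]]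
        bounded_linear.linear by blast
    have "incl_map S M q (Y q) c = incl_deriv c \<sigma> q (\<Sum>b\<in>?B. inner b (Y q \<sigma>) *\<^sub>R b)"
      by (simp add: incl_apply[OF c(1) q(3) \<sigma>(1) q(1) Yq]
          onb_expansion[OF S.subspace_model S.tangent_vector_mem_model[OF Yq \<sigma>(1) q(1)]])
    also have "\<dots> = (\<Sum>b\<in>?B. inner b (Y q \<sigma>) *\<^sub>R incl_deriv c \<sigma> q b)"
      by (simp add: linear_sum[OF lin] linear_scale[OF lin])
    finally show ?thesis by (simp add: q(4) S.chart_inv_chart[OF \<sigma>(1) q(1)] incl_deriv_def)
  qed
  show ?thesis by (rule that[OF has_derivative_transform_openin[OF A pA eq der]])
qed

lemma connection_along_coord:
  assumes \<sigma>: "\<sigma> \<in> atlas S" "p \<in> fst \<sigma>" and X: "X p \<in> tangent_space S p"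
    and Z: "((\<lambda>q. Z q (chart_at M p)) \<circ> chart_inv \<sigma> has_derivative Z') (at (snd \<sigma> p) within model S)"
  shows "connection_along M S D X Z p = coord_vector M (chart_at M p)
    (Z' (X p \<sigma>) + \<Gamma> (chart_at M p) p (incl_map S M p (X p) (chart_at M p)) (Z p (chart_at M p))) p"
  using S.dirder_eq[OF \<sigma> X Z] by (simp add: connection_along_def Let_def christoffel_def)

lemma points_subset: "points S \<subseteq> points M"
  using immersed by (simp add: immersed_submanifold_def)

text \<open>Any preimages \<open>k\<close>, \<open>l\<close> may be used, which shows that the leaf
  form is well defined.\<close>

lemma leaf_form_coord:
  assumes c: "c \<in> atlas M" "q \<in> fst c" and q: "q \<in> points S"
    and u: "u \<in> tangent_space S q" "incl_map S M q u c = P c q k"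
    and v: "v \<in> tangent_space S q" "incl_map S M q v c = P c q l"
  shows "leaf_form M \<pi> S q u v = inner l (P c q k)"
  unfolding leaf_form_def
proof (rule the_equality)
  have eq: "incl_map S M q u = coord_vector M c (P c q k) q" "incl_map S M q v = coord_vector M c (P c q l) q"
    using tangent_vector_eq[OF incl_component(2)[OF c q u(1)] c] u(2)
      tangent_vector_eq[OF incl_component(2)[OF c q v(1)] c] v(2) by auto
  show "\<exists>\<alpha>\<in>cotangent_space M q. \<exists>\<beta>\<in>cotangent_space M q. sharp M \<pi> q \<alpha> = incl_map S M q u \<and>
      sharp M \<pi> q \<beta> = incl_map S M q v \<and> inner l (P c q k) = \<pi> q \<alpha> \<beta>"
    by (intro bexI[of _ "coord_covector M c k q"] bexI[of _ "coord_covector M c l q"]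
        coord_covector_mem[OF c]) (simp add: sharp_coord_covector[OF c] eq inner_anchor[OF c])
next
  fix r assume "\<exists>\<alpha>\<in>cotangent_space M q. \<exists>\<beta>\<in>cotangent_space M q. sharp M \<pi> q \<alpha> = incl_map S M q u \<and>
      sharp M \<pi> q \<beta> = incl_map S M q v \<and> r = \<pi> q \<alpha> \<beta>"
  then obtain \<alpha> \<beta> where \<alpha>\<beta>: "\<alpha> \<in> cotangent_space M q" "\<beta> \<in> cotangent_space M q"
    "sharp M \<pi> q \<alpha> = incl_map S M q u" "sharp M \<pi> q \<beta> = incl_map S M q v" "r = \<pi> q \<alpha> \<beta>" by blast
  obtain k' where k': "\<alpha> = coord_covector M c k' q" using cotangent_space_coord[OF c \<alpha>\<beta>(1)] .
  obtain l' where l': "\<beta> = coord_covector M c l' q" using cotangent_space_coord[OF c \<alpha>\<beta>(2)] .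
  have "P c q k' = P c q k" "P c q l' = P c q l"
    unfolding u(2)[symmetric] v(2)[symmetric] \<alpha>\<beta>(3,4)[symmetric] k' l' sharp_coord_covector[OF c]
      coord_vector_self[OF c anchor_mem_model] by (rule refl)+
  moreover have "inner a (P c q b) = - inner b (P c q a)" for a b
    using skew_anchor[OF c] unfolding skew_def by blast
  \<comment> \<open>Replace \<open>k'\<close> by \<open>k\<close>, swap by skewness, replace
    \<open>l'\<close> by \<open>l\<close>, and swap back.\<close>
  ultimately have "inner l' (P c q k') = inner l (P c q k)" by metis
  then show "r = inner l (P c q k)" by (simp add: \<alpha>\<beta>(5) k' l' inner_anchor[OF c])
qed

lemma connection_along_mem:
  assumes W: "openin (mtop S) W" "p \<in> W" and X: "X \<in> vector_fields S W" and Y: "Y \<in> vector_fields S W"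
  shows "connection_along M S D X (\<lambda>q. incl_map S M q (Y q)) p \<in> sub_tangent_space S M p"
proof -
  \<comment> \<open>\<open>connection_along\<close> computes in this particular chart, so
    \<open>c\<close> is not free here.\<close>
  define c where "c = chart_at M p"
  have p: "p \<in> points S" using W openin_subset by blast
  then have c: "c \<in> atlas M" "p \<in> fst c" unfolding c_def using chart_at points_subset by auto
  obtain \<sigma> where \<sigma>: "\<sigma> \<in> atlas S" "p \<in> fst \<sigma>" using S.points_chartE[OF p] .
  obtain Z' where Z': "((\<lambda>q. incl_map S M q (Y q) c) \<circ> chart_inv \<sigma> has_derivative Z')
      (at (snd \<sigma> p) within model S)"
    using incl_field_has_derivative[OF c \<sigma> W Y] .
  have mem: "incl_map S M q (Y q) c \<in> range (P c q)" if "q \<in> W" "q \<in> fst c" for q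
    using that openin_subset[OF W(1)] by (intro incl_component c S.vector_fields_mem[OF Y]) auto
  note Xp = S.vector_fields_mem[OF X W(2)]
  show ?thesis
    unfolding connection_along_coord[where X = X and Z = "\<lambda>q. incl_map S M q (Y q)", OF \<sigma> Xp Z'[unfolded c_def]] c_def[symmetric] sub_tangent_space_coord[OF c p]
    by (intro imageI covariant_derivative_in_range[OF c \<sigma> W mem Z' Xp])
qed

text \<open>For fields of \<open>M\<close>, the derivative of \<open>Y\<close> in a direction
  tangent to the leaf depends only on the restriction of \<open>Y\<close> to the leaf, so both
  conjuncts rest on \<open>covariant_derivative_in_range\<close>.\<close>

lemma totally_geodesic: "totally_geodesic M D S"
  unfolding totally_geodesic_def
proof (intro conjI allI ballI impI)
  fix U X Y p
  assume X: "X \<in> vector_fields M U" and Y: "Y \<in> vector_fields M U" and p: "p \<in> U \<inter> points S"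
    and U: "openin (mtop M) U \<and>
      (\<forall>p\<in>U \<inter> points S. X p \<in> sub_tangent_space S M p \<and> Y p \<in> sub_tangent_space S M p)"
  obtain c where c: "c \<in> atlas M" "p \<in> fst c" using points_chartE points_subset p by blast
  obtain \<sigma> where \<sigma>: "\<sigma> \<in> atlas S" "p \<in> fst \<sigma>" using S.points_chartE p by blast
  obtain v where v: "v \<in> tangent_space S p" "X p = incl_map S M p v"
    using U p by (auto simp: sub_tangent_space_def)
  have W: "openin (mtop S) (points S \<inter> U)" "p \<in> points S \<inter> U"
  proof -
    have "continuous_map (mtop S) (mtop M) id"
      using immersed by (simp add: immersed_submanifold_def smooth_map_def)
    from openin_continuous_map_preimage[OF this, of U] show "openin (mtop S) (points S \<inter> U)"
      using U by (simp add: Int_def)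
  qed (use p in auto)
  let ?Y' = "frechet_derivative ((\<lambda>q. Y q c) \<circ> chart_inv c) (at (snd c p) within model M)"
  have Y': "((\<lambda>q. Y q c) \<circ> chart_inv c has_derivative ?Y') (at (snd c p) within model M)"
    by (rule smooth_fun_has_derivative[OF vector_fields_smooth[OF Y c(1)] c]) (use p c in auto)
  have pU: "openin (mtop M) U" "p \<in> U" using U p by auto
  have "D X Y p c = ?Y' (incl_deriv c \<sigma> p (v \<sigma>)) + \<Gamma> c p (incl_map S M p v c) (Y p c)"
    using connection_coord[OF pU c X Y] dirder_eq[OF c vector_fields_mem[OF X pU(2)] Y']
    by (simp add: v(2) incl_apply[OF c \<sigma> v(1)])
  also have "\<dots> \<in> range (P c p)"
    by (rule covariant_derivative_in_range[OF c \<sigma> W _ has_derivative_along_incl[OF c \<sigma> Y'] v(1)])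
       (use U sub_tangent_space_component(1)[OF c(1)] in auto)
  finally have "D X Y p c \<in> range (P c p)" .
  moreover have "D X Y p = coord_vector M c (D X Y p c) p"
    using tangent_vector_eq[OF vector_fields_mem[OF connection_mem[OF pU(1) X Y] pU(2)] c] by simp
  ultimately show "D X Y p \<in> sub_tangent_space S M p"
    using sub_tangent_space_coord[OF c] p by blast
qed (rule connection_along_mem)

lemma parallel_leaf_form:
  "parallel_two_form S (restricted_connection M D S) (leaf_form M \<pi> S)"
  unfolding parallel_two_form_def
proof (intro allI ballI impI)
  fix W X Y Z p
  assume X: "X \<in> vector_fields S W" and Y: "Y \<in> vector_fields S W" and Z: "Z \<in> vector_fields S W"
    and "openin (mtop S) W" "p \<in> W"
  note W = this(4,5)
  define c where "c = chart_at M p"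
  let ?N = "restricted_connection M D S" and ?i = "\<lambda>Y q. incl_map S M q (Y q) c"
  have WS: "W \<subseteq> points S" using W openin_subset by blast
  then have p: "p \<in> points S" using W by blast
  then have c: "c \<in> atlas M" "p \<in> fst c" unfolding c_def using chart_at points_subset by auto
  obtain \<sigma> where \<sigma>: "\<sigma> \<in> atlas S" "p \<in> fst \<sigma>" using S.points_chartE[OF p] .
  obtain Y' where Y': "(?i Y \<circ> chart_inv \<sigma> has_derivative Y') (at (snd \<sigma> p) within model S)"
    using incl_field_has_derivative[OF c \<sigma> W Y] .
  obtain Z' where Z': "(?i Z \<circ> chart_inv \<sigma> has_derivative Z') (at (snd \<sigma> p) within model S)"
    using incl_field_has_derivative[OF c \<sigma> W Z] .
  have mem: "?i Y q \<in> range (P c q)" if "q \<in> W" "q \<in> fst c" "Y \<in> vector_fields S W" for q Y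
    using that WS by (intro incl_component c S.vector_fields_mem[OF that(3)]) auto
  note Xp = S.vector_fields_mem[OF X W(2)] and Yp = S.vector_fields_mem[OF Y W(2)]
    and Zp = S.vector_fields_mem[OF Z W(2)]
  let ?cov = "\<lambda>Y Y'. Y' (X p \<sigma>) + \<Gamma> c p (?i X p) (?i Y p)"
  have cov: "?cov Y Y' \<in> range (P c p)" "?N X Y p \<in> tangent_space S p" "incl_map S M p (?N X Y p) c = ?cov Y Y'"
    if Y: "Y \<in> vector_fields S W"
      and Y': "(?i Y \<circ> chart_inv \<sigma> has_derivative Y') (at (snd \<sigma> p) within model S)" for Y Y'
  proof -
    show r: "?cov Y Y' \<in> range (P c p)"
      by (rule covariant_derivative_in_range[OF c \<sigma> W mem[OF _ _ Y] Y' Xp])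
    \<comment> \<open>Total geodesy is what makes the \<open>inv_into\<close> in
      \<open>restricted_connection\<close> a genuine inverse here.\<close>
    have in_image: "connection_along M S D X (\<lambda>q. incl_map S M q (Y q)) p
        \<in> incl_map S M p ` tangent_space S p"
      using connection_along_mem[OF W X Y] by (simp add: sub_tangent_space_def)
    show "?N X Y p \<in> tangent_space S p"
      unfolding restricted_connection_def by (rule inv_into_into[OF in_image])
    have "incl_map S M p (?N X Y p) = connection_along M S D X (\<lambda>q. incl_map S M q (Y q)) p"
      unfolding restricted_connection_def by (rule f_inv_into_f[OF in_image])
    also have "\<dots> = coord_vector M c (?cov Y Y') p"
      using connection_along_coord[where X = X and Z = "\<lambda>q. incl_map S M q (Y q)", OF \<sigma> Xp Y'[unfolded c_def]] by (simp add: c_def)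
    finally show "incl_map S M p (?N X Y p) c = ?cov Y Y'"
      using r anchor_mem_model[of c p] coord_vector_self[OF c] by auto
  qed
  obtain k where k: "?i Y p = P c p k" using mem[OF W(2) c(2) Y] by auto
  obtain l where l: "?i Z p = P c p l" using mem[OF W(2) c(2) Z] by auto
  obtain h where h: "?cov Y Y' = P c p h" using cov(1)[OF Y Y'] by auto
  obtain j where j: "?cov Z Z' = P c p j" using cov(1)[OF Z Z'] by auto
  have "dirder S (\<lambda>q. leaf_form M \<pi> S q (Y q) (Z q)) p (X p) = inner l (?cov Y Y') - inner k (?cov Z Z')"
  proof (rule dirder_pairing[OF c \<sigma> W mem[OF _ _ Y] Y' mem[OF _ _ Z] Z' Xp _ k[symmetric] l[symmetric]])
    fix q k l assume q: "q \<in> W" "q \<in> fst c" and "P c q k = ?i Y q" "P c q l = ?i Z q"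
    then show "leaf_form M \<pi> S q (Y q) (Z q) = inner l (P c q k)"
      using WS by (intro leaf_form_coord[OF c(1)] S.vector_fields_mem[OF Y] S.vector_fields_mem[OF Z]) auto
  qed
  moreover have "leaf_form M \<pi> S p (?N X Y p) (Z p) = inner l (?cov Y Y')"
    unfolding h by (rule leaf_form_coord[OF c p cov(2)[OF Y Y'] _ Zp l]) (simp add: cov(3)[OF Y Y'] h)
  moreover have "leaf_form M \<pi> S p (Y p) (?N X Z p) = inner j (P c p k)"
    by (rule leaf_form_coord[OF c p Yp k cov(2)[OF Z Z']]) (simp add: cov(3)[OF Z Z'] j)
  \<comment> \<open>Skewness matches the sign with which the derivative of \<open>Z\<close> enters
    \<open>dirder_pairing\<close>.\<close>
  moreover have "inner j (P c p k) = - inner k (?cov Z Z')"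
    unfolding j using skew_anchor[OF c] unfolding skew_def by blast
  ultimately show "dirder S (\<lambda>q. leaf_form M \<pi> S q (Y q) (Z q)) p (X p)
      - leaf_form M \<pi> S p (?N X Y p) (Z p) - leaf_form M \<pi> S p (Y p) (?N X Z p) = 0"
    by simp
qed

end

theorem mainTheorem1:
  fixes M S :: "('a, 'e::euclidean_space) mfd"
    and g :: "'a \<Rightarrow> ('a, 'e) tvec \<Rightarrow> ('a, 'e) tvec \<Rightarrow> real"
    and \<pi> :: "'a \<Rightarrow> ('a, 'e) covec \<Rightarrow> ('a, 'e) covec \<Rightarrow> real"
    and D :: "('a, 'e) conn"
  assumes "smooth_manifold M"
    and "pseudo_riemannian_metric M g"
    and "bivector_field M \<pi>"
    and "levi_civita_connection M g D"
    and "pi_compatible M D \<pi>"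
    and "symplectic_leaf M \<pi> S"
  shows "totally_geodesic M D S \<and>
         parallel_two_form S (restricted_connection M D S) (leaf_form M \<pi> S)"
proof -
  have "integral_mfd M D \<pi> S"
    using assms
    by unfold_locales
       (auto simp: levi_civita_connection_def symplectic_leaf_def integral_manifold_def
         immersed_submanifold_def)
  then show ?thesis using integral_mfd.totally_geodesic integral_mfd.parallel_leaf_form by blast
qed

end
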